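(* Let $(X,d)$ be a nonempty compact metric space and let $\{\tau_n\}_{n\in\mathbb{N}}$ be a sequence of positive real numbers satisfying $\tau_{n+1}<\frac{\tau_n}{2}$ for every $n\in\mathbb{N}$. For every $n$ let $B_n$ be a $\tau_n$-approximation of $X$, and consider the inverse sequence $(\mathcal{U}_{4\tau_n}(B_n),q_{n,n+1})$ with $q_{n,n+1}(C)=\bigcup_{x\in C}\mathcal{B}(x,\tau_n)\cap B_n$. Then for every integer $k\geq 0$ the inverse limit of the inverse sequence of groups $(H_k(\mathcal{U}_{4\tau_n}(B_n)),H_k(q_{n,n+1}))$ is isomorphic to the $k$-th Čech homology group of $X$.
   Context: For $\epsilon>0$, a finite subset $A\subseteq X$ is an $\epsilon$-approximation of $X$ if for every $x\in X$ there is $a\in A$ with $d(x,a)<\epsilon$. $\mathcal{B}(x,\epsilon)$ is the open ball. For an $\epsilon$-approximation $A$, $\mathcal{U}_{4\epsilon}(A)$ is the finite set of all nonempty $C\subseteq A$ with $\mathrm{diam}(C)<4\epsilon$, ordered by $C\leq D$ iff $D\subseteq C$, with the topology whose open sets are the lower sets of $\leq$ (the minimal open neighborhood of $C$ is $\{D : C\subseteq D\}$). The maps $q_{n,n+1}:\mathcal{U}_{4\tau_{n+1}}(B_{n+1})\to\mathcal{U}_{4\tau_n}(B_n)$ are well-defined and continuous. $H_k$ denotes singular homology with integer coefficients. The $k$-th Čech homology group of $X$ is the inverse limit, over the open covers $\mathcal{V}$ of $X$ directed by refinement, of the groups $H_k(N(\mathcal{V}))$ of the nerves, with the maps induced by refinement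 projections. *)

theory Defs
  imports "HOL-Homology.Homology"
begin

section \<open>The finite spaces of an approximation\<close>

definition approximation :: "'a::metric_space set \<Rightarrow> real \<Rightarrow> 'a set \<Rightarrow> bool" where
  "approximation X \<epsilon> A \<longleftrightarrow> finite A \<and> A \<subseteq> X \<and> (\<forall>x\<in>X. \<exists>a\<in>A. dist x a < \<epsilon>)"

definition small_sets :: "real \<Rightarrow> 'a::metric_space set \<Rightarrow> 'a set set" where
  "small_sets r A = {C. C \<noteq> {} \<and> C \<subseteq> A \<and> diameter C < r}"

text \<open>The order on \<open>small_sets r A\<close> is reversed inclusion, so the lower sets are the upwards closed
  families: the minimal open neighbourhood of \<open>C\<close> consists of the members containing \<open>C\<close>.\<close>

definition small_le :: "'a set \<Rightarrow> 'a set \<Rightarrow> bool" where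
  "small_le C D \<longleftrightarrow> D \<subseteq> C"

definition small_space :: "real \<Rightarrow> 'a::metric_space set \<Rightarrow> 'a set topology" where
  "small_space r A = topology (\<lambda>W. W \<subseteq> small_sets r A \<and>
     (\<forall>C\<in>W. \<forall>D\<in>small_sets r A. small_le D C \<longrightarrow> D \<in> W))"

lemma openin_small_space:
  "openin (small_space r A) W \<longleftrightarrow> W \<subseteq> small_sets r A \<and>
     (\<forall>C\<in>W. \<forall>D\<in>small_sets r A. small_le D C \<longrightarrow> D \<in> W)"
proof -
  have "istopology (\<lambda>W. W \<subseteq> small_sets r A \<and>
     (\<forall>C\<in>W. \<forall>D\<in>small_sets r A. small_le D C \<longrightarrow> D \<in> W))"
    unfolding istopology_def by blast
  then show ?thesis
    by (simp add: small_space_def topology_inverse')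
qed

lemma topspace_small_space [simp]: "topspace (small_space r A) = small_sets r A"
proof
  show "topspace (small_space r A) \<subseteq> small_sets r A"
    using openin_small_space[of r A "topspace (small_space r A)"] by simp
  have "openin (small_space r A) (small_sets r A)"
    by (simp add: openin_small_space)
  then show "small_sets r A \<subseteq> topspace (small_space r A)"
    by (rule openin_subset)
qed

definition bond :: "(nat \<Rightarrow> real) \<Rightarrow> (nat \<Rightarrow> 'a::metric_space set) \<Rightarrow> nat \<Rightarrow> 'a set \<Rightarrow> 'a set" where
  "bond \<tau> B n C = (\<Union>x\<in>C. ball x (\<tau> n) \<inter> B n)"

section \<open>Inverse limits of groups\<close>

text \<open>A triple \<open>(i, j, f)\<close> in \<open>F\<close> stands for a bonding map \<open>f\<close> from \<open>G j\<close> to \<open>G i\<close>.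
  The limit consists of the families in the product that are compatible with all of \<open>F\<close>.\<close>

definition inverse_limit ::
    "'i set \<Rightarrow> ('i \<Rightarrow> 'b monoid) \<Rightarrow> ('i \<times> 'i \<times> ('b \<Rightarrow> 'b)) set \<Rightarrow> ('i \<Rightarrow> 'b) monoid" where
  "inverse_limit I G F =
     (product_group I G)\<lparr>carrier :=
        {x \<in> carrier (product_group I G). \<forall>(i, j, f)\<in>F. f (x j) = x i}\<rparr>"

lemma group_inverse_limit:
  assumes G: "\<And>i. i \<in> I \<Longrightarrow> group (G i)"
    and F: "\<And>i j f. (i, j, f) \<in> F \<Longrightarrow> i \<in> I \<and> j \<in> I \<and> f \<in> hom (G j) (G i)"
  shows "group (inverse_limit I G F)"
proof -
  interpret P: group "product_group I G"
    by (simp add: G)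
  have "subgroup {x \<in> carrier (product_group I G). \<forall>(i, j, f)\<in>F. f (x j) = x i} (product_group I G)"
  proof (rule P.subgroupI)
    have "f \<one>\<^bsub>G j\<^esub> = \<one>\<^bsub>G i\<^esub>" if "(i, j, f) \<in> F" for i j f
      using F[OF that] G hom_one by blast
    then have "\<one>\<^bsub>product_group I G\<^esub> \<in> {x \<in> carrier (product_group I G). \<forall>(i, j, f)\<in>F. f (x j) = x i}"
      using F P.one_closed by fastforce
    then show "{x \<in> carrier (product_group I G). \<forall>(i, j, f)\<in>F. f (x j) = x i} \<noteq> {}"
      by blast
  next
    fix a assume a: "a \<in> {x \<in> carrier (product_group I G). \<forall>(i, j, f)\<in>F. f (x j) = x i}"
    have "f (inv\<^bsub>G j\<^esub> a j) = inv\<^bsub>G i\<^esub> a i" if "(i, j, f) \<in> F" for i j f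
    proof -
      have *: "i \<in> I" "j \<in> I" "f \<in> hom (G j) (G i)" using F[OF that] by auto
      then interpret group_hom "G j" "G i" f
        by (simp add: G group_hom_axioms_def group_hom_def)
      have "a j \<in> carrier (G j)" "f (a j) = a i" using a * that by (auto dest: PiE_mem)
      then show ?thesis using hom_inv[of "a j"] by simp
    qed
    then show "inv\<^bsub>product_group I G\<^esub> a \<in> {x \<in> carrier (product_group I G). \<forall>(i, j, f)\<in>F. f (x j) = x i}"
      using a F G P.inv_closed[of a] by (fastforce simp: inv_product_group)
  next
    fix a b
    assume a: "a \<in> {x \<in> carrier (product_group I G). \<forall>(i, j, f)\<in>F. f (x j) = x i}"
      and b: "b \<in> {x \<in> carrier (product_group I G). \<forall>(i, j, f)\<in>F. f (x j) = x i}"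
    have "f (a j \<otimes>\<^bsub>G j\<^esub> b j) = a i \<otimes>\<^bsub>G i\<^esub> b i" if "(i, j, f) \<in> F" for i j f
    proof -
      have *: "i \<in> I" "j \<in> I" "f \<in> hom (G j) (G i)" using F[OF that] by auto
      have "a j \<in> carrier (G j)" "f (a j) = a i" "b j \<in> carrier (G j)" "f (b j) = b i"
        using a b * that by (auto dest: PiE_mem)
      then show ?thesis using hom_mult[OF *(3)] by simp
    qed
    then show "a \<otimes>\<^bsub>product_group I G\<^esub> b \<in> {x \<in> carrier (product_group I G). \<forall>(i, j, f)\<in>F. f (x j) = x i}"
      using a b F P.m_closed[of a b] by fastforce
  qed auto
  then show ?thesis
    unfolding inverse_limit_def by (rule P.subgroup_imp_group)
qed

section \<open>Geometric realization of an abstract simplicial complex\<close>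

text \<open>A complex is given by its set \<open>K\<close> of (finite nonempty) simplices; points of the
  realization are given by their barycentric coordinates.\<close>

definition realization_points :: "'v set set \<Rightarrow> ('v \<Rightarrow> real) set" where
  "realization_points K =
     {t. (\<forall>v. 0 \<le> t v) \<and> {v. t v \<noteq> 0} \<in> K \<and> (\<Sum>v | t v \<noteq> 0. t v) = 1}"

definition closed_simplex :: "'v set set \<Rightarrow> 'v set \<Rightarrow> ('v \<Rightarrow> real) set" where
  "closed_simplex K \<sigma> = {t \<in> realization_points K. {v. t v \<noteq> 0} \<subseteq> \<sigma>}"

text \<open>The weak (coherent) topology: each closed simplex, having finitely many vertices, carries
  its Euclidean topology, and a set is open iff it meets every closed simplex in an open set.\<close>

definition realization :: "'v set set \<Rightarrow> ('v \<Rightarrow> real) topology" where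
  "realization K = topology (\<lambda>W. W \<subseteq> realization_points K \<and>
     (\<forall>\<sigma>\<in>K. openin (subtopology (powertop_real UNIV) (closed_simplex K \<sigma>)) (W \<inter> closed_simplex K \<sigma>)))"

lemma openin_realization:
  "openin (realization K) W \<longleftrightarrow> W \<subseteq> realization_points K \<and>
     (\<forall>\<sigma>\<in>K. openin (subtopology (powertop_real UNIV) (closed_simplex K \<sigma>)) (W \<inter> closed_simplex K \<sigma>))"
proof -
  have "istopology (\<lambda>W. W \<subseteq> realization_points K \<and>
     (\<forall>\<sigma>\<in>K. openin (subtopology (powertop_real UNIV) (closed_simplex K \<sigma>)) (W \<inter> closed_simplex K \<sigma>)))"
    unfolding istopology_def
  proof (intro conjI allI impI)
    fix S T
    assume "S \<subseteq> realization_points K \<and> (\<forall>\<sigma>\<in>K. openin (subtopology (powertop_real UNIV) (closed_simplex K \<sigma>)) (S \<inter> closed_simplex K \<sigma>))"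
      and "T \<subseteq> realization_points K \<and> (\<forall>\<sigma>\<in>K. openin (subtopology (powertop_real UNIV) (closed_simplex K \<sigma>)) (T \<inter> closed_simplex K \<sigma>))"
    moreover have "S \<inter> T \<inter> closed_simplex K \<sigma> = (S \<inter> closed_simplex K \<sigma>) \<inter> (T \<inter> closed_simplex K \<sigma>)" for \<sigma>
      by blast
    ultimately show "S \<inter> T \<subseteq> realization_points K"
      and "\<forall>\<sigma>\<in>K. openin (subtopology (powertop_real UNIV) (closed_simplex K \<sigma>)) (S \<inter> T \<inter> closed_simplex K \<sigma>)"
      by (auto intro: openin_Int)
  next
    fix \<K>
    assume *: "\<forall>S\<in>\<K>. S \<subseteq> realization_points K \<and> (\<forall>\<sigma>\<in>K. openin (subtopology (powertop_real UNIV) (closed_simplex K \<sigma>)) (S \<inter> closed_simplex K \<sigma>))"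
    have "\<Union>\<K> \<inter> closed_simplex K \<sigma> = (\<Union>S\<in>\<K>. S \<inter> closed_simplex K \<sigma>)" for \<sigma>
      by blast
    moreover have "openin (subtopology (powertop_real UNIV) (closed_simplex K \<sigma>)) (\<Union>S\<in>\<K>. S \<inter> closed_simplex K \<sigma>)"
      if "\<sigma> \<in> K" for \<sigma>
      by (rule openin_Union) (use * that in blast)
    ultimately show "\<Union>\<K> \<subseteq> realization_points K"
      and "\<forall>\<sigma>\<in>K. openin (subtopology (powertop_real UNIV) (closed_simplex K \<sigma>)) (\<Union>\<K> \<inter> closed_simplex K \<sigma>)"
      using * by auto
  qed
  then show ?thesis
    by (simp add: realization_def topology_inverse')
qed

lemma topspace_realization [simp]: "topspace (realization K) = realization_points K"
proof
  show "topspace (realization K) \<subseteq> realization_points K"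
    using openin_realization[of K "topspace (realization K)"] by simp
  have "closed_simplex K \<sigma> \<subseteq> realization_points K" for \<sigma>
    by (auto simp: closed_simplex_def)
  then have "realization_points K \<inter> closed_simplex K \<sigma> = closed_simplex K \<sigma>" for \<sigma>
    by blast
  then have "openin (realization K) (realization_points K)"
    by (simp add: openin_realization openin_subtopology_refl)
  then show "realization_points K \<subseteq> topspace (realization K)"
    by (rule openin_subset)
qed

text \<open>The affine extension of a map of vertices.\<close>

definition realization_map :: "('v \<Rightarrow> 'w) \<Rightarrow> ('v \<Rightarrow> real) \<Rightarrow> 'w \<Rightarrow> real" where
  "realization_map p t = (\<lambda>w. \<Sum>v | t v \<noteq> 0 \<and> p v = w. t v)"

section \<open>Cech homology\<close>

definition open_cover :: "'a::topological_space set \<Rightarrow> 'a set set \<Rightarrow> bool" where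
  "open_cover X \<V> \<longleftrightarrow> (\<forall>V\<in>\<V>. openin (top_of_set X) V) \<and> \<Union>\<V> = X"

definition nerve :: "'a set set \<Rightarrow> 'a set set set" where
  "nerve \<V> = {\<sigma>. finite \<sigma> \<and> \<sigma> \<noteq> {} \<and> \<sigma> \<subseteq> \<V> \<and> \<Inter>\<sigma> \<noteq> {}}"

definition refinement_projection :: "'a set set \<Rightarrow> 'a set set \<Rightarrow> ('a set \<Rightarrow> 'a set) \<Rightarrow> bool" where
  "refinement_projection \<W> \<V> p \<longleftrightarrow> (\<forall>W\<in>\<W>. p W \<in> \<V> \<and> W \<subseteq> p W)"

text \<open>All projections between two covers are contiguous and so induce the same map in homology;
  hence the limit is taken over all of them rather than over a choice of one for each pair
  of covers.\<close>

definition Cech_homology_group ::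
    "nat \<Rightarrow> 'a::topological_space set \<Rightarrow> ('a set set \<Rightarrow> ('a set \<Rightarrow> real) chain set) monoid" where
  "Cech_homology_group k X =
     inverse_limit {\<V>. open_cover X \<V>}
       (\<lambda>\<V>. homology_group (int k) (realization (nerve \<V>)))
       {(\<V>, \<W>, hom_induced (int k) (realization (nerve \<W>)) {} (realization (nerve \<V>)) {}
                  (realization_map p)) | \<V> \<W> p.
          open_cover X \<V> \<and> open_cover X \<W> \<and> refinement_projection \<W> \<V> p}"

end

theory Submission
  imports Defs
begin

text \<open>
  A point of the realization of a finite complex \<open>K\<close> is sent to its support, a face of \<open>K\<close>; this map
  from the realization to the finite space of faces induces isomorphisms in homology (McCord), by
  induction over open sets of faces with the five lemma and excision, because minimal open sets and
  open stars are contractible.  The spaces of the theorem are thus replaced by the Vietoris--Rips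
  complexes \<open>K\<^sub>n\<close> on \<open>B\<^sub>n\<close>, and the bonding map by any simplicial map that moves points less than
  \<open>\<tau>\<^sub>n\<close>.

  If \<open>4\<tau>\<^sub>n\<close>-balls fit into members of a cover \<open>\<V>\<close> (Lebesgue number), choosing such members gives
  a simplicial map from \<open>K\<^sub>n\<close> to the nerve of \<open>\<V>\<close>; if the members of a finite cover \<open>\<W>\<close> fit
  into \<open>2\<tau>\<^sub>n\<close>-balls, choosing centres gives a simplicial map from the nerve of \<open>\<W>\<close> to \<open>K\<^sub>n\<close>.
  All choices are contiguous after passing to a larger index or a common refinement.  One composite is
  a refinement projection, the other moves points less than \<open>\<tau>\<^sub>n\<close>, so the two constructions are
  mutually inverse on the limits.
\<close>

section \<open>The five lemma and homology isomorphisms\<close>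

text \<open>Diagram chase: \<open>h' y\<close> lifts through \<open>d\<close>; the lift dies under
  \<open>k\<close> because \<open>e\<close> is injective, so it comes from some \<open>z\<close> in
  \<open>C\<close>. Then \<open>y\<close> and \<open>c z\<close> differ by an element coming from
  \<open>B'\<close>, hence from \<open>B\<close>. Commutativity is not assumed, so the correcting
  factor stays on the left. The lists in \<open>exact_seq\<close> run from the last group back to
  the first.\<close>

lemma four_lemma_epi:
  assumes top: "exact_seq ([E, D, C, B], [k, h, g])" and bot: "exact_seq ([E', D', C', B'], [k', h', g'])"
    and hom: "b \<in> hom B B'" "c \<in> hom C C'" "d \<in> hom D D'" "e \<in> hom E E'"
    and b: "b ` carrier B = carrier B'" and d: "d ` carrier D = carrier D'" and e: "inj_on e (carrier E)"
    and gb: "\<And>x. x \<in> carrier B \<Longrightarrow> c (g x) = g' (b x)"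
    and hc: "\<And>x. x \<in> carrier C \<Longrightarrow> d (h x) = h' (c x)"
    and kd: "\<And>x. x \<in> carrier D \<Longrightarrow> e (k x) = k' (d x)"
  shows "c ` carrier C = carrier C'"
proof
  interpret g: group_hom B C g using top by simp
  interpret h: group_hom C D h using top by (simp add: group_hom_def group_hom_axioms_def)
  interpret k: group_hom D E k using top by (simp add: group_hom_def group_hom_axioms_def)
  interpret g': group_hom B' C' g' using bot by simp
  interpret h': group_hom C' D' h' using bot by (simp add: group_hom_def group_hom_axioms_def)
  interpret k': group_hom D' E' k' using bot by (simp add: group_hom_def group_hom_axioms_def)
  interpret c: group_hom C C' c using hom by unfold_locales
  interpret d: group_hom D D' d using hom by unfold_locales
  interpret e: group_hom E E' e using hom by unfold_locales
  have ex: "kernel D E k = h ` carrier C" "kernel C D h = g ` carrier B"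
    "kernel D' E' k' = h' ` carrier C'" "kernel C' D' h' = g' ` carrier B'"
    using top bot by simp_all
  show "c ` carrier C \<subseteq> carrier C'" by auto
  show "carrier C' \<subseteq> c ` carrier C"
  proof
    fix y assume y: "y \<in> carrier C'"
    then have "h' y \<in> d ` carrier D" using d by simp
    then obtain x where x: "x \<in> carrier D" "d x = h' y" by force
    have "h' y \<in> kernel D' E' k'" unfolding ex using y by blast
    then have "e (k x) = e \<one>\<^bsub>E\<^esub>" using x kd by (simp add: kernel_def)
    then have "k x = \<one>\<^bsub>E\<^esub>" using inj_on_eq_iff[OF e, of "k x" "\<one>\<^bsub>E\<^esub>"] x by simp
    then have "x \<in> kernel D E k" using x by (simp add: kernel_def)
    then obtain z where z: "z \<in> carrier C" "h z = x" unfolding ex by force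
    define w where "w = y \<otimes>\<^bsub>C'\<^esub> inv\<^bsub>C'\<^esub> c z"
    have w: "w \<in> carrier C'" using y z by (simp add: w_def)
    have "h' w = \<one>\<^bsub>D'\<^esub>" using y z x hc[of z] by (simp add: w_def)
    then have "w \<in> kernel C' D' h'" using w by (simp add: kernel_def)
    then obtain u where u: "u \<in> carrier B'" "g' u = w" unfolding ex by force
    have "u \<in> b ` carrier B" using b u by simp
    then obtain v where v: "v \<in> carrier B" "b v = u" by force
    have "c (g v \<otimes>\<^bsub>C\<^esub> z) = w \<otimes>\<^bsub>C'\<^esub> c z" using u v z gb by simp
    also have "\<dots> = y" unfolding w_def using y z g'.H.m_assoc[of y "inv\<^bsub>C'\<^esub> c z" "c z"] by simp
    finally have "y = c (g v \<otimes>\<^bsub>C\<^esub> z)" by simp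
    moreover have "g v \<otimes>\<^bsub>C\<^esub> z \<in> carrier C" using v z by simp
    ultimately show "y \<in> c ` carrier C" by (rule image_eqI)
  qed
qed

text \<open>The dual chase: an element killed by \<open>c\<close> is killed by \<open>h\<close>, so
  it comes from some \<open>y\<close> in \<open>B\<close>. Then \<open>b y\<close> comes from
  \<open>A'\<close>, hence from \<open>A\<close>, and injectivity of \<open>b\<close> puts
  \<open>y\<close> itself in the image of \<open>f\<close>.\<close>

lemma four_lemma_mono:
  assumes top: "exact_seq ([D, C, B, A], [h, g, f])" and bot: "exact_seq ([D', C', B', A'], [h', g', f'])"
    and hom: "a \<in> hom A A'" "b \<in> hom B B'" "c \<in> hom C C'" "d \<in> hom D D'"
    and a: "a ` carrier A = carrier A'" and b: "inj_on b (carrier B)" and d: "inj_on d (carrier D)"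
    and fa: "\<And>x. x \<in> carrier A \<Longrightarrow> b (f x) = f' (a x)"
    and gb: "\<And>x. x \<in> carrier B \<Longrightarrow> c (g x) = g' (b x)"
    and hc: "\<And>x. x \<in> carrier C \<Longrightarrow> d (h x) = h' (c x)"
  shows "inj_on c (carrier C)"
proof -
  interpret f: group_hom A B f using top by simp
  interpret g: group_hom B C g using top by (simp add: group_hom_def group_hom_axioms_def)
  interpret h: group_hom C D h using top by (simp add: group_hom_def group_hom_axioms_def)
  interpret f': group_hom A' B' f' using bot by simp
  interpret g': group_hom B' C' g' using bot by (simp add: group_hom_def group_hom_axioms_def)
  interpret h': group_hom C' D' h' using bot by (simp add: group_hom_def group_hom_axioms_def)
  interpret b: group_hom B B' b using hom by unfold_locales
  interpret c: group_hom C C' c using hom by unfold_locales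
  interpret d: group_hom D D' d using hom by unfold_locales
  have ex: "kernel C D h = g ` carrier B" "kernel B C g = f ` carrier A"
    "kernel C' D' h' = g' ` carrier B'" "kernel B' C' g' = f' ` carrier A'"
    using top bot by simp_all
  have "x = \<one>\<^bsub>C\<^esub>" if x: "x \<in> carrier C" "c x = \<one>\<^bsub>C'\<^esub>" for x
  proof -
    have "d (h x) = d \<one>\<^bsub>D\<^esub>" using x hc by simp
    then have "h x = \<one>\<^bsub>D\<^esub>" using inj_on_eq_iff[OF d, of "h x" "\<one>\<^bsub>D\<^esub>"] x by simp
    then have "x \<in> kernel C D h" using x by (simp add: kernel_def)
    then obtain y where y: "y \<in> carrier B" "g y = x" unfolding ex by force
    have "g' (b y) = \<one>\<^bsub>C'\<^esub>" using y x gb[of y] by simp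
    then have "b y \<in> kernel B' C' g'" using y by (simp add: kernel_def)
    then obtain z where z: "z \<in> carrier A'" "f' z = b y" unfolding ex by force
    have "z \<in> a ` carrier A" using a z by simp
    then obtain u where u: "u \<in> carrier A" "a u = z" by force
    have "b (f u) = b y" using u z fa[of u] by simp
    then have "f u = y" using inj_on_eq_iff[OF b] u y by simp
    then have "y \<in> kernel B C g" unfolding ex using u by force
    then show ?thesis using y by (simp add: kernel_def)
  qed
  then show ?thesis unfolding c.inj_iff_trivial_ker kernel_def by auto
qed

lemma five_lemma:
  assumes top: "exact_seq ([E, D, C, B, A], [k, h, g, f])"
    and bot: "exact_seq ([E', D', C', B', A'], [k', h', g', f'])"
    and hom: "a \<in> iso A A'" "b \<in> iso B B'" "c \<in> hom C C'" "d \<in> iso D D'" "e \<in> iso E E'"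
    and comm: "\<And>x. x \<in> carrier A \<Longrightarrow> b (f x) = f' (a x)"
      "\<And>x. x \<in> carrier B \<Longrightarrow> c (g x) = g' (b x)"
      "\<And>x. x \<in> carrier C \<Longrightarrow> d (h x) = h' (c x)"
      "\<And>x. x \<in> carrier D \<Longrightarrow> e (k x) = k' (d x)"
  shows "c \<in> iso C C'"
proof -
  have ex: "exact_seq ([E, D, C, B], [k, h, g])" "exact_seq ([E', D', C', B'], [k', h', g'])"
    "exact_seq ([D, C, B, A], [h, g, f])" "exact_seq ([D', C', B', A'], [h', g', f'])"
    using top bot by (simp_all add: group_hom_def group_hom_axioms_def)
  have ab: "a \<in> hom A A'" "b \<in> hom B B'" "d \<in> hom D D'" "e \<in> hom E E'"
    "a ` carrier A = carrier A'" "b ` carrier B = carrier B'" "d ` carrier D = carrier D'"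
    "inj_on b (carrier B)" "inj_on d (carrier D)" "inj_on e (carrier E)"
    using hom by (auto simp: iso_def bij_betw_def)
  have "c ` carrier C = carrier C'"
    by (rule four_lemma_epi[OF ex(1,2) ab(2) hom(3) ab(3,4,6,7,10)]) (erule comm)+
  moreover have "inj_on c (carrier C)"
    by (rule four_lemma_mono[OF ex(3,4) ab(1,2) hom(3) ab(3,5,8,9)]) (erule comm)+
  ultimately show ?thesis using hom by (simp add: iso_def bij_betw_def)
qed

section \<open>Homology isomorphisms for pairs and unions\<close>

text \<open>All degrees are taken at once because the five lemma mixes neighbouring ones. Continuity
  is part of the notion, since \<open>hom_induced\<close> is trivial on discontinuous maps.\<close>

definition homology_iso :: "'a topology \<Rightarrow> 'b topology \<Rightarrow> ('a \<Rightarrow> 'b) \<Rightarrow> bool" where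
  "homology_iso X Y f \<longleftrightarrow> continuous_map X Y f \<and>
     (\<forall>p. hom_induced p X {} Y {} f \<in> iso (homology_group p X) (homology_group p Y))"

text \<open>Five lemma in the exact sequences of the two pairs, with the relative group in the
  middle.\<close>

lemma relative_homology_iso:
  assumes X: "homology_iso X Y f" and S: "homology_iso (subtopology X S) (subtopology Y T) f"
    and f: "f \<in> S \<rightarrow> T"
  shows "hom_induced p X S Y T f \<in> iso (relative_homology_group p X S) (relative_homology_group p Y T)"
proof -
  have c: "continuous_map X Y f" "continuous_map (subtopology X S) (subtopology Y T) f"
    using X S by (auto simp: homology_iso_def)
  have i: "continuous_map (subtopology X S) X id" "continuous_map (subtopology Y T) Y id"
    by (auto intro: continuous_map_from_subtopology continuous_map_id)
  have sq: "hom_induced q X {} Y {} f (hom_induced q (subtopology X S) {} X {} id x)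
        = hom_induced q (subtopology Y T) {} Y {} id (hom_induced q (subtopology X S) {} (subtopology Y T) {} f x)"
      "hom_induced q X S Y T f (hom_induced q X {} X S id x)
        = hom_induced q Y {} Y T id (hom_induced q X {} Y {} f x)" for q x
    using c i f by (simp_all add: hom_induced_compose')
  have nat: "hom_boundary q Y T (hom_induced q X S Y T f x)
        = hom_induced (q - 1) (subtopology X S) {} (subtopology Y T) {} f (hom_boundary q X S x)" for q x
    using naturality_hom_induced[OF c(1) f] by (rule comp_eq_dest)
  show ?thesis
  proof (rule five_lemma[where a = "hom_induced p (subtopology X S) {} (subtopology Y T) {} f"
        and b = "hom_induced p X {} Y {} f" and d = "hom_induced (p-1) (subtopology X S) {} (subtopology Y T) {} f"
        and e = "hom_induced (p-1) X {} Y {} f"])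
    show "exact_seq ([homology_group (p-1) X, homology_group (p-1) (subtopology X S),
        relative_homology_group p X S, homology_group p X, homology_group p (subtopology X S)],
        [hom_induced (p-1) (subtopology X S) {} X {} id, hom_boundary p X S, hom_induced p X {} X S id,
         hom_induced p (subtopology X S) {} X {} id])"
      using homology_exactness_axiom_1[of p X S] homology_exactness_axiom_2[of p X S]
        homology_exactness_axiom_3[of p X S] by simp
    show "exact_seq ([homology_group (p-1) Y, homology_group (p-1) (subtopology Y T),
        relative_homology_group p Y T, homology_group p Y, homology_group p (subtopology Y T)],
        [hom_induced (p-1) (subtopology Y T) {} Y {} id, hom_boundary p Y T, hom_induced p Y {} Y T id,
         hom_induced p (subtopology Y T) {} Y {} id])"
      using homology_exactness_axiom_1[of p Y T] homology_exactness_axiom_2[of p Y T]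
        homology_exactness_axiom_3[of p Y T] by simp
  qed (use X S in \<open>simp_all only: homology_iso_def hom_induced_hom nat sq\<close>)
qed

text \<open>The same ladder shifted by one place, so that the absolute group of \<open>X\<close> is
  in the middle; it now starts with the relative group in degree \<open>p + 1\<close>.\<close>

lemma homology_iso_if_relative:
  assumes X: "continuous_map X Y f" and S: "homology_iso (subtopology X S) (subtopology Y T) f"
    and f: "f \<in> S \<rightarrow> T"
    and rel: "\<And>p. hom_induced p X S Y T f \<in> iso (relative_homology_group p X S) (relative_homology_group p Y T)"
  shows "homology_iso X Y f"
proof -
  have c: "continuous_map X Y f" "continuous_map (subtopology X S) (subtopology Y T) f"
    using X S by (auto simp: homology_iso_def)
  have i: "continuous_map (subtopology X S) X id" "continuous_map (subtopology Y T) Y id"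
    by (auto intro: continuous_map_from_subtopology continuous_map_id)
  have sq: "hom_induced q X {} Y {} f (hom_induced q (subtopology X S) {} X {} id x)
        = hom_induced q (subtopology Y T) {} Y {} id (hom_induced q (subtopology X S) {} (subtopology Y T) {} f x)"
      "hom_induced q X S Y T f (hom_induced q X {} X S id x)
        = hom_induced q Y {} Y T id (hom_induced q X {} Y {} f x)" for q x
    using c i f by (simp_all add: hom_induced_compose')
  have nat: "hom_boundary q Y T (hom_induced q X S Y T f x)
        = hom_induced (q - 1) (subtopology X S) {} (subtopology Y T) {} f (hom_boundary q X S x)" for q x
    using naturality_hom_induced[OF c(1) f] by (rule comp_eq_dest)
  have "hom_induced p X {} Y {} f \<in> iso (homology_group p X) (homology_group p Y)" for p
  proof (rule five_lemma[where a = "hom_induced (p+1) X S Y T f"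
        and b = "hom_induced p (subtopology X S) {} (subtopology Y T) {} f" and d = "hom_induced p X S Y T f"
        and e = "hom_induced (p-1) (subtopology X S) {} (subtopology Y T) {} f"])
    show "exact_seq ([homology_group (p-1) (subtopology X S),
        relative_homology_group p X S, homology_group p X, homology_group p (subtopology X S),
        relative_homology_group (p+1) X S],
        [hom_boundary p X S, hom_induced p X {} X S id,
         hom_induced p (subtopology X S) {} X {} id, hom_boundary (p+1) X S])"
      using homology_exactness_axiom_1[of p X S] homology_exactness_axiom_2[of "p+1" X S]
        homology_exactness_axiom_3[of p X S] by simp
    show "exact_seq ([homology_group (p-1) (subtopology Y T),
        relative_homology_group p Y T, homology_group p Y, homology_group p (subtopology Y T),
        relative_homology_group (p+1) Y T],
        [hom_boundary p Y T, hom_induced p Y {} Y T id,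
         hom_induced p (subtopology Y T) {} Y {} id, hom_boundary (p+1) Y T])"
      using homology_exactness_axiom_1[of p Y T] homology_exactness_axiom_2[of "p+1" Y T]
        homology_exactness_axiom_3[of p Y T] by simp
  qed (use X S rel nat[of "p+1"] in \<open>simp_all only: homology_iso_def hom_induced_hom nat sq add_diff_cancel_right'\<close>)
  then show ?thesis using X by (simp add: homology_iso_def)
qed

text \<open>The part \<open>V - U\<close> is excised from the union: it is closed there because
  \<open>U\<close> is open, and it lies in \<open>V\<close>, which is its own interior.\<close>

lemma excision_open:
  assumes U: "openin X U" and V: "openin X V"
  shows "hom_induced p (subtopology X U) (U \<inter> V) (subtopology X (U \<union> V)) V id
    \<in> iso (relative_homology_group p (subtopology X U) (U \<inter> V))
          (relative_homology_group p (subtopology X (U \<union> V)) V)"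
proof -
  let ?Z = "subtopology X (U \<union> V)"
  have UV: "U \<subseteq> topspace X" "V \<subseteq> topspace X" using U V by (auto dest: openin_subset)
  have "openin ?Z U" "openin ?Z V"
    using U V openin_subtopology_Int[of X U "U \<union> V"] openin_subtopology_Int[of X V "U \<union> V"]
    by (simp_all add: Int_absorb2)
  moreover have "topspace ?Z - U = V - U" using UV by auto
  ultimately have "closedin ?Z (V - U)" "?Z interior_of V = V"
    using openin_closedin_eq[of ?Z U] by (simp_all add: interior_of_openin)
  then have "?Z closure_of (V - U) \<subseteq> ?Z interior_of V"
    by (simp add: closure_of_closedin)
  then have "hom_induced p (subtopology ?Z (U \<union> V - (V - U))) (V - (V - U)) (subtopology ?Z (U \<union> V)) V id
    \<in> iso (relative_homology_group p (subtopology ?Z (U \<union> V - (V - U))) (V - (V - U)))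
          (relative_homology_group p (subtopology ?Z (U \<union> V)) V)"
    by (rule homology_excision_axiom) auto
  moreover have "U \<union> V - (V - U) = U" "V - (V - U) = U \<inter> V" "(U \<union> V) \<inter> U = U"
    by auto
  ultimately show ?thesis by (simp add: subtopology_subtopology)
qed

text \<open>Takes the place of a Mayer-Vietoris argument: excision turns the pair (union,
  \<open>V\<close>) into (\<open>U\<close>, intersection), where the five lemma applies; together
  with the isomorphism on \<open>V\<close> this gives the union.\<close>

lemma homology_iso_Un:
  assumes f: "continuous_map X Y f"
    and U: "openin Y U" and V: "openin Y V" and U': "openin X U'" and V': "openin X V'"
    and im: "f \<in> U' \<rightarrow> U" "f \<in> V' \<rightarrow> V"
    and isoU: "homology_iso (subtopology X U') (subtopology Y U) f"
    and isoV: "homology_iso (subtopology X V') (subtopology Y V) f"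
    and isoI: "homology_iso (subtopology X (U' \<inter> V')) (subtopology Y (U \<inter> V)) f"
  shows "homology_iso (subtopology X (U' \<union> V')) (subtopology Y (U \<union> V)) f"
proof (rule homology_iso_if_relative)
  have cU: "continuous_map (subtopology X U') (subtopology Y U) f"
    using isoU by (simp add: homology_iso_def)
  show c: "continuous_map (subtopology X (U' \<union> V')) (subtopology Y (U \<union> V)) f"
    using f im by (auto simp: continuous_map_in_subtopology intro: continuous_map_from_subtopology)
  have s: "subtopology (subtopology X (U' \<union> V')) V' = subtopology X V'"
    "subtopology (subtopology Y (U \<union> V)) V = subtopology Y V"
    "subtopology (subtopology X U') (U' \<inter> V') = subtopology X (U' \<inter> V')"
    "subtopology (subtopology Y U) (U \<inter> V) = subtopology Y (U \<inter> V)"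
    by (simp_all add: subtopology_subtopology Int_absorb1 flip: Int_assoc)
  show "homology_iso (subtopology (subtopology X (U' \<union> V')) V') (subtopology (subtopology Y (U \<union> V)) V) f"
    using isoV s by simp
  show "f \<in> V' \<rightarrow> V" by (rule im)
  fix p
  have imI: "f \<in> U' \<inter> V' \<rightarrow> U \<inter> V" using im by auto
  let ?eX = "hom_induced p (subtopology X U') (U' \<inter> V') (subtopology X (U' \<union> V')) V' id"
  let ?eY = "hom_induced p (subtopology Y U) (U \<inter> V) (subtopology Y (U \<union> V)) V id"
  let ?g = "hom_induced p (subtopology X U') (U' \<inter> V') (subtopology Y U) (U \<inter> V) f"
  let ?f = "hom_induced p (subtopology X (U' \<union> V')) V' (subtopology Y (U \<union> V)) V f"
  have eX: "bij_betw ?eX (carrier (relative_homology_group p (subtopology X U') (U' \<inter> V')))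
       (carrier (relative_homology_group p (subtopology X (U' \<union> V')) V'))"
    using excision_open[OF U' V', of p] by (simp add: iso_def)
  have eY: "bij_betw ?eY (carrier (relative_homology_group p (subtopology Y U) (U \<inter> V)))
       (carrier (relative_homology_group p (subtopology Y (U \<union> V)) V))"
    using excision_open[OF U V, of p] by (simp add: iso_def)
  have g: "bij_betw ?g (carrier (relative_homology_group p (subtopology X U') (U' \<inter> V')))
       (carrier (relative_homology_group p (subtopology Y U) (U \<inter> V)))"
    using relative_homology_iso[OF isoU _ imI, of p] isoI s by (simp add: iso_def)
  have i: "continuous_map (subtopology X U') (subtopology X (U' \<union> V')) id"
    "continuous_map (subtopology Y U) (subtopology Y (U \<union> V)) id"
    by (auto simp: continuous_map_in_subtopology intro: continuous_map_from_subtopology)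
  \<comment> \<open>Both composites are induced by \<open>f\<close> as a map of pairs from
    (\<open>U'\<close>, intersection) to (union, \<open>V\<close>).\<close>
  have "?f \<circ> ?eX = ?eY \<circ> ?g"
    using hom_induced_compose[OF i(1) _ c im(2), of "U' \<inter> V'" p]
      hom_induced_compose[OF cU imI i(2), of V p] by auto
  then have "bij_betw (?f \<circ> ?eX) (carrier (relative_homology_group p (subtopology X U') (U' \<inter> V')))
       (carrier (relative_homology_group p (subtopology Y (U \<union> V)) V))"
    using bij_betw_trans[OF g eY] by simp
  then have "bij_betw ?f (carrier (relative_homology_group p (subtopology X (U' \<union> V')) V'))
       (carrier (relative_homology_group p (subtopology Y (U \<union> V)) V))"
    using bij_betw_comp_iff[OF eX] by blast
  then show "?f \<in> iso (relative_homology_group p (subtopology X (U' \<union> V')) V')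
       (relative_homology_group p (subtopology Y (U \<union> V)) V)"
    by (simp add: iso_def hom_induced_hom)
qed

text \<open>A constant map into \<open>X\<close> is a homotopy inverse. Its value comes from
  nonemptiness, as the empty space counts as contractible.\<close>

lemma homology_iso_contractible:
  assumes f: "continuous_map X Y f" and X: "contractible_space X" "topspace X \<noteq> {}" and Y: "contractible_space Y"
  shows "homology_iso X Y f"
proof -
  obtain a where a: "a \<in> topspace X" using X by blast
  have "f a \<in> topspace Y" using a f by (auto simp: continuous_map_def)
  then have "homotopic_with (\<lambda>x. True) Y Y (f \<circ> (\<lambda>y. a)) id"
    using Y by (simp add: contractible_space_alt homotopic_with_sym comp_def)
  moreover have "homotopic_with (\<lambda>x. True) X X ((\<lambda>y. a) \<circ> f) id"
    using X a by (simp add: contractible_space_alt homotopic_with_sym comp_def)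
  ultimately show ?thesis
    using a f homotopy_equivalence_homology_group_isomorphism[of X Y f "\<lambda>y. a"]
    by (simp add: homology_iso_def)
qed

section \<open>Spaces of faces\<close>

text \<open>Arbitrary families of sets are allowed: an open set of faces need not be a complex, yet
  as a subspace it is again of this form.\<close>

definition face_space :: "'v set set \<Rightarrow> 'v set topology" where
  "face_space K = topology (\<lambda>W. W \<subseteq> K \<and> (\<forall>C\<in>W. \<forall>D\<in>K. C \<subseteq> D \<longrightarrow> D \<in> W))"

lemma small_space_eq_face_space: "small_space r A = face_space (small_sets r A)"
  by (simp add: small_space_def face_space_def small_le_def)

lemma openin_face_space:
  "openin (face_space K) W \<longleftrightarrow> W \<subseteq> K \<and> (\<forall>C\<in>W. \<forall>D\<in>K. C \<subseteq> D \<longrightarrow> D \<in> W)"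
proof -
  have "istopology (\<lambda>W. W \<subseteq> K \<and> (\<forall>C\<in>W. \<forall>D\<in>K. C \<subseteq> D \<longrightarrow> D \<in> W))"
    unfolding istopology_def by blast
  then show ?thesis by (simp add: face_space_def topology_inverse')
qed

lemma topspace_face_space [simp]: "topspace (face_space K) = K"
proof
  show "topspace (face_space K) \<subseteq> K"
    using openin_face_space[of K "topspace (face_space K)"] by simp
  show "K \<subseteq> topspace (face_space K)"
    by (rule openin_subset) (simp add: openin_face_space)
qed

lemma subtopology_face_space:
  assumes "openin (face_space K) W"
  shows "subtopology (face_space K) W = face_space W"
  unfolding topology_eq
  using assms by (auto simp: openin_open_subtopology openin_face_space)

definition face_map :: "'v set set \<Rightarrow> 'w set set \<Rightarrow> ('v set \<Rightarrow> 'w set) \<Rightarrow> bool" where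
  "face_map K L f \<longleftrightarrow> f \<in> K \<rightarrow> L \<and> (\<forall>C\<in>K. \<forall>D\<in>K. C \<subseteq> D \<longrightarrow> f C \<subseteq> f D)"

lemma continuous_face_map: "face_map K L f \<Longrightarrow> continuous_map (face_space K) (face_space L) f"
  by (auto simp: face_map_def continuous_map openin_face_space Pi_iff)

text \<open>The homotopy is \<open>f\<close> at time 0 and jumps to \<open>g\<close> immediately afterwards.\<close>

lemma homotopic_face_maps:
  assumes f: "face_map K L f" and g: "face_map K L g" and le: "\<And>C. C \<in> K \<Longrightarrow> f C \<subseteq> g C"
  shows "homotopic_with (\<lambda>x. True) (face_space K) (face_space L) f g"
proof -
  let ?I = "top_of_set {0..1::real}"
  let ?h = "\<lambda>(t::real, C). if t = 0 then f C else g C"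
  have "continuous_map (prod_topology ?I (face_space K)) (face_space L) ?h"
    unfolding continuous_map
  proof (intro conjI allI impI)
    show "?h ` topspace (prod_topology ?I (face_space K)) \<subseteq> topspace (face_space L)"
      using f g by (auto simp: face_map_def)
    fix W assume W: "openin (face_space L) W"
    have up: "g C \<in> W" if "C \<in> K" "f C \<in> W" for C
      using W that le[of C] funcset_mem[of g K L C] g by (auto simp: openin_face_space face_map_def)
    \<comment> \<open>By \<open>up\<close> the preimage under \<open>f\<close> lies in that under
      \<open>g\<close>, so its box may extend over the whole interval, which makes both boxes
      open.\<close>
    have "{x \<in> topspace (prod_topology ?I (face_space K)). ?h x \<in> W}
        = {0..1} \<times> {C \<in> K. f C \<in> W} \<union> {0<..1} \<times> {C \<in> K. g C \<in> W}"
      using up by (auto split: if_splits)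
    moreover have "openin (face_space K) {C \<in> K. f C \<in> W}" "openin (face_space K) {C \<in> K. g C \<in> W}"
      using openin_continuous_map_preimage[OF continuous_face_map[OF f] W]
        openin_continuous_map_preimage[OF continuous_face_map[OF g] W] by simp_all
    moreover have "{0<..1} = {0..1::real} \<inter> {0<..}"
      by auto
    then have "openin ?I {0<..1}"
      by (metis openin_open_Int open_greaterThan)
    moreover have "openin ?I {0..1}"
      by (simp add: openin_subtopology_self)
    ultimately show "openin (prod_topology ?I (face_space K)) {x \<in> topspace (prod_topology ?I (face_space K)). ?h x \<in> W}"
      by (auto simp: openin_prod_Times_iff intro!: openin_Un)
  qed
  then show ?thesis
    by (auto simp: homotopic_with intro!: exI[where x = ?h])
qed

text \<open>The constant map at \<open>C\<close> lies below the identity, so the two are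
  homotopic.\<close>

lemma contractible_face_space_minimum:
  assumes "C \<in> K" "\<And>D. D \<in> K \<Longrightarrow> C \<subseteq> D"
  shows "contractible_space (face_space K)"
  unfolding contractible_space_def
  by (rule exI[where x = C], rule homotopic_with_symD, rule homotopic_face_maps)
     (use assms in \<open>auto simp: face_map_def\<close>)

definition simplicial_complex :: "'v set set \<Rightarrow> bool" where
  "simplicial_complex K \<longleftrightarrow> (\<forall>\<sigma>\<in>K. finite \<sigma> \<and> \<sigma> \<noteq> {} \<and> (\<forall>\<rho>. \<rho> \<noteq> {} \<longrightarrow> \<rho> \<subseteq> \<sigma> \<longrightarrow> \<rho> \<in> K))"

lemma simplicial_complexD:
  assumes "simplicial_complex K" "\<sigma> \<in> K"
  shows "finite \<sigma>" "\<sigma> \<noteq> {}" "\<rho> \<noteq> {} \<Longrightarrow> \<rho> \<subseteq> \<sigma> \<Longrightarrow> \<rho> \<in> K"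
  using bspec[OF assms(1)[unfolded simplicial_complex_def] assms(2)] by blast+

section \<open>The support map\<close>

definition supp :: "('v \<Rightarrow> real) \<Rightarrow> 'v set" where
  "supp t = {v. t v \<noteq> 0}"

lemma realization_points_iff:
  "t \<in> realization_points K \<longleftrightarrow> (\<forall>v. 0 \<le> t v) \<and> supp t \<in> K \<and> sum t (supp t) = 1"
  by (simp add: realization_points_def supp_def)

lemma closed_simplex_iff: "t \<in> closed_simplex K \<sigma> \<longleftrightarrow> t \<in> realization_points K \<and> supp t \<subseteq> \<sigma>"
  by (simp add: closed_simplex_def supp_def)

lemma openin_realization_iff:
  "openin (realization K) W \<longleftrightarrow> W \<subseteq> realization_points K \<and>
     (\<forall>\<sigma>\<in>K. openin (top_of_set (closed_simplex K \<sigma>)) (W \<inter> closed_simplex K \<sigma>))"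
  by (simp add: openin_realization euclidean_product_topology)

lemma open_positive_coordinates:
  fixes C :: "'v set"
  assumes "finite C"
  shows "open {t :: 'v \<Rightarrow> real. \<forall>v\<in>C. 0 < t v}"
proof -
  have "open {t :: 'v \<Rightarrow> real. 0 < t v}" for v
    by (intro open_Collect_less continuous_intros continuous_on_product_coordinates)
  moreover have "{t :: 'v \<Rightarrow> real. \<forall>v\<in>C. 0 < t v} = (\<Inter>v\<in>C. {t. 0 < t v})" by blast
  ultimately show ?thesis using assms by auto
qed

text \<open>Since \<open>W\<close> is upward closed, a support belongs to \<open>W\<close> as soon
  as the point is positive on some member of \<open>W\<close>, and positivity on a finite set is an
  open condition.\<close>

lemma continuous_map_supp:
  assumes "\<And>\<sigma>. \<sigma> \<in> K \<Longrightarrow> finite \<sigma>"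
  shows "continuous_map (realization K) (face_space K) supp"
  unfolding continuous_map
proof (intro conjI allI impI)
  show "supp ` topspace (realization K) \<subseteq> topspace (face_space K)"
    by (auto simp: realization_points_iff)
  fix W assume W: "openin (face_space K) W"
  have "openin (top_of_set (closed_simplex K \<sigma>)) ({t \<in> realization_points K. supp t \<in> W} \<inter> closed_simplex K \<sigma>)"
    if "\<sigma> \<in> K" for \<sigma>
  proof -
    have "{t \<in> realization_points K. supp t \<in> W} \<inter> closed_simplex K \<sigma>
        = closed_simplex K \<sigma> \<inter> (\<Union>C\<in>W. {t. \<forall>v\<in>C. 0 < t v})" (is "?A = ?B")
    proof
      show "?A \<subseteq> ?B"
        by (auto simp: realization_points_iff supp_def less_le)
      show "?B \<subseteq> ?A"
      proof
        fix t assume t: "t \<in> ?B"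
        then obtain C where "C \<in> W" "\<forall>v\<in>C. 0 < t v" by blast
        moreover from this have "C \<subseteq> supp t" by (force simp: supp_def)
        moreover have "supp t \<in> K" using t by (simp add: closed_simplex_iff realization_points_iff)
        ultimately have "supp t \<in> W" using W by (auto simp: openin_face_space)
        then show "t \<in> ?A" using t by (auto simp: closed_simplex_iff)
      qed
    qed
    moreover have "open (\<Union>C\<in>W. {t. \<forall>v\<in>C. 0 < (t v::real)})"
      using W assms by (intro open_UN ballI open_positive_coordinates) (auto simp: openin_face_space)
    ultimately show ?thesis by (auto intro: openin_open_Int)
  qed
  then show "openin (realization K) {x \<in> topspace (realization K). supp x \<in> W}"
    by (auto simp: openin_realization_iff)
qed

section \<open>Finite complexes: open stars and the comparison with the space of faces\<close>

lemma closedin_closed_simplex: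
  fixes K :: "'v set set"
  shows "closedin (top_of_set (realization_points K)) (closed_simplex K \<sigma>)"
proof -
  have "closed {t :: 'v \<Rightarrow> real. \<forall>v\<in>-\<sigma>. t v = 0}"
    unfolding Ball_def
    by (intro closed_Collect_all closed_Collect_imp closed_Collect_eq open_Collect_const continuous_intros
        continuous_on_product_coordinates)
  moreover have "closed_simplex K \<sigma> = realization_points K \<inter> {t. \<forall>v\<in>-\<sigma>. t v = 0}"
    by (auto simp: closed_simplex_iff supp_def)
  ultimately show ?thesis by (auto simp: closedin_closed)
qed

text \<open>The complement of a weakly open set is a union of closed pieces, one in each closed
  simplex, and finiteness of \<open>K\<close> keeps the union closed. In the product topology,
  continuity of straight-line homotopies is a coordinatewise check.\<close>

lemma realization_finite:
  assumes "finite K"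
  shows "realization K = top_of_set (realization_points K)"
  unfolding topology_eq
proof (intro allI iffI)
  fix W assume W: "openin (realization K) W"
  have "closedin (top_of_set (realization_points K)) (closed_simplex K \<sigma> - W)" if "\<sigma> \<in> K" for \<sigma>
  proof -
    have "closedin (top_of_set (closed_simplex K \<sigma>)) (closed_simplex K \<sigma> - W \<inter> closed_simplex K \<sigma>)"
      using W that closedin_diff[OF closedin_topspace] by (force simp: openin_realization_iff)
    moreover have "closed_simplex K \<sigma> - W \<inter> closed_simplex K \<sigma> = closed_simplex K \<sigma> - W"
      by blast
    ultimately show ?thesis
      using closedin_closed_simplex closedin_trans by metis
  qed
  then have "closedin (top_of_set (realization_points K)) (\<Union>\<sigma>\<in>K. closed_simplex K \<sigma> - W)"
    using assms by (intro closedin_Union) auto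
  moreover have "(\<Union>\<sigma>\<in>K. closed_simplex K \<sigma> - W) = realization_points K - W"
    by (auto simp: closed_simplex_iff realization_points_iff)
  moreover have "W \<subseteq> realization_points K" using W by (simp add: openin_realization_iff)
  ultimately show "openin (top_of_set (realization_points K)) W"
    by (simp add: openin_closedin_eq)
next
  fix W assume "openin (top_of_set (realization_points K)) W"
  then obtain T where T: "open T" "W = realization_points K \<inter> T"
    by (auto simp: openin_open)
  have "W \<inter> closed_simplex K \<sigma> = closed_simplex K \<sigma> \<inter> T" for \<sigma>
    using T by (auto simp: closed_simplex_iff)
  then show "openin (realization K) W"
    using T by (auto simp: openin_realization_iff openin_open_Int)
qed

text \<open>Straight-line contraction to the barycentre \<open>b\<close> of \<open>C\<close>. The
  support is unchanged before time 1 and becomes \<open>C\<close> at time 1, so every segment stays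
  inside the star.\<close>

lemma contractible_open_star:
  fixes K :: "'v set set"
  assumes K: "simplicial_complex K" "finite K" and C: "C \<in> K"
  shows "contractible_space (subtopology (realization K) {t \<in> realization_points K. C \<subseteq> supp t})"
    and "{t \<in> realization_points K. C \<subseteq> supp t} \<noteq> {}"
proof -
  let ?S = "{t \<in> realization_points K. C \<subseteq> supp t}"
  have fin: "finite C" "C \<noteq> {}" using K C by (auto simp: simplicial_complex_def)
  define b where "b v = (if v \<in> C then 1 / real (card C) else 0)" for v
  have b0: "0 \<le> b v" for v by (simp add: b_def)
  have suppb: "supp b = C" using fin by (auto simp: supp_def b_def)
  have sumb: "sum b D = 1" if "C \<subseteq> D" "finite D" for D
  proof -
    have "sum b D = sum b C" using that by (intro sum.mono_neutral_right) (auto simp: b_def)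
    also have "\<dots> = 1" using fin by (simp add: b_def)
    finally show ?thesis .
  qed
  have b: "b \<in> ?S" using C b0 suppb sumb fin by (simp add: realization_points_iff)
  then show "?S \<noteq> {}" by blast
  define h where "h = (\<lambda>(s::real, t::'v \<Rightarrow> real) v. (1 - s) * t v + s * b v)"
  have h: "h (s, t) \<in> ?S" if s: "0 \<le> s" "s \<le> 1" and t: "t \<in> ?S" for s t
  proof -
    have t0: "0 \<le> t v" for v using t by (simp add: realization_points_iff)
    have st: "supp t \<in> K" "finite (supp t)" "C \<subseteq> supp t" "sum t (supp t) = 1"
      using t K by (auto simp: realization_points_iff simplicial_complex_def)
    have sup: "supp (h (s, t)) = (if s = 1 then C else supp t)"
    proof (cases "s = 1")
      case True
      then show ?thesis using suppb by (simp add: supp_def h_def)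
    next
      case False
      then have "h (s, t) v \<noteq> 0 \<longleftrightarrow> t v \<noteq> 0" for v
        using s t0[of v] b0[of v] st(3) suppb
        by (auto simp: h_def supp_def add_nonneg_eq_0_iff)
      then show ?thesis using False by (simp add: supp_def)
    qed
    have "sum (h (s, t)) (supp (h (s, t))) = sum (h (s, t)) (supp t)"
      using st sup by (intro sum.mono_neutral_left) (auto simp: supp_def)
    also have "\<dots> = (1 - s) * sum t (supp t) + s * sum b (supp t)"
      by (simp add: h_def sum.distrib sum_distrib_left)
    also have "\<dots> = 1" using st sumb by simp
    finally show ?thesis
      using sup st C s t0 b0 by (simp add: realization_points_iff h_def)
  qed
  have "continuous_on ({0..1} \<times> ?S) h"
    unfolding h_def case_prod_unfold
    by (intro continuous_intros continuous_on_product_then_coordinatewise)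
  moreover have "h \<in> {0..1} \<times> ?S \<rightarrow> ?S" using h by fastforce
  ultimately have "continuous_map (prod_topology (top_of_set {0..1}) (top_of_set ?S)) (top_of_set ?S) h"
    by simp
  then have "homotopic_with_canon (\<lambda>x. True) ?S ?S id (\<lambda>x. b)"
    unfolding homotopic_with_def by (intro exI[where x = h] conjI) (simp_all add: h_def)
  then have "contractible_space (top_of_set ?S)"
    unfolding contractible_space_def by blast
  moreover have "realization_points K \<inter> ?S = ?S" by blast
  then have "subtopology (realization K) ?S = top_of_set ?S"
    by (simp add: realization_finite[OF K(2)] subtopology_subtopology)
  ultimately show "contractible_space (subtopology (realization K) ?S)" by simp
qed

text \<open>Base case of the induction below. Any function out of an empty space is continuous, so
  \<open>undefined\<close> can serve as the inverse.\<close>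

lemma homology_iso_empty:
  assumes "topspace X = {}" "topspace Y = {}"
  shows "homology_iso X Y f"
proof -
  have "homotopic_with (\<lambda>h. True) X X (undefined \<circ> f) id" "homotopic_with (\<lambda>h. True) Y Y (f \<circ> undefined) id"
    using assms by (auto intro!: homotopic_with_equal simp: continuous_map_def)
  moreover have "continuous_map X Y f" "continuous_map Y X undefined"
    using assms by (auto simp: continuous_map_def)
  ultimately show ?thesis
    by (simp add: homology_iso_def homotopy_equivalence_homology_group_isomorphism)
qed

text \<open>A McCord type argument by induction on \<open>card W\<close>. All open sets are included
  in the statement because the gluing step calls the induction on a smaller piece and on an
  intersection. A minimal \<open>C\<close> generates an open set with a least element, whose
  preimage is the open star of \<open>C\<close>; both are contractible.\<close>

lemma homology_iso_supp_open:
  assumes K: "simplicial_complex K" "finite K" and W: "openin (face_space K) W"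
  shows "homology_iso (subtopology (realization K) {t \<in> realization_points K. supp t \<in> W})
           (subtopology (face_space K) W) supp"
  using W
proof (induction "card W" arbitrary: W rule: less_induct)
  case less
  let ?pre = "\<lambda>W. {t \<in> realization_points K. supp t \<in> W}"
  have cont: "continuous_map (realization K) (face_space K) supp"
    using K by (intro continuous_map_supp) (auto simp: simplicial_complex_def)
  have pre: "openin (realization K) (?pre V)" if "openin (face_space K) V" for V
    using openin_continuous_map_preimage[OF cont that] by simp
  have WK: "W \<subseteq> K" and up: "\<And>C D. C \<in> W \<Longrightarrow> D \<in> K \<Longrightarrow> C \<subseteq> D \<Longrightarrow> D \<in> W"
    using less.prems by (auto simp: openin_face_space)
  have finW: "finite W" using WK K finite_subset by blast
  show ?case
  proof (cases "W = {}")
    case True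
    then show ?thesis by (intro homology_iso_empty) auto
  next
    case False
    then obtain C where C: "C \<in> W" and min: "\<And>D. D \<in> W \<Longrightarrow> D \<subseteq> C \<Longrightarrow> C = D"
      using finite_has_minimal[OF finW] by metis
    \<comment> \<open>\<open>W\<close> is the union of the contractible \<open>U\<close> and the smaller open set \<open>W - {C}\<close>.\<close>
    define U where "U = {D \<in> K. C \<subseteq> D}"
    have CK: "C \<in> K" using C WK by blast
    have oU: "openin (face_space K) U" by (auto simp: openin_face_space U_def)
    \<comment> \<open>Minimality of \<open>C\<close> keeps the remaining family upward
      closed.\<close>
    have oV: "openin (face_space K) (W - {C})"
      using less.prems min by (auto simp: openin_face_space)
    have oI: "openin (face_space K) (U \<inter> (W - {C}))" using oU oV by (rule openin_Int)
    have eq: "U \<union> (W - {C}) = W" using up C CK by (auto simp: U_def)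
    have preU: "?pre U = {t \<in> realization_points K. C \<subseteq> supp t}"
      by (auto simp: U_def realization_points_iff)
    have "contractible_space (subtopology (face_space K) U)"
      unfolding subtopology_face_space[OF oU]
      using CK by (intro contractible_face_space_minimum[of C]) (auto simp: U_def)
    then have iU: "homology_iso (subtopology (realization K) (?pre U)) (subtopology (face_space K) U) supp"
      using contractible_open_star[OF K CK] cont preU
      by (intro homology_iso_contractible)
        (auto simp: continuous_map_in_subtopology U_def intro: continuous_map_from_subtopology)
    have iV: "homology_iso (subtopology (realization K) (?pre (W - {C}))) (subtopology (face_space K) (W - {C})) supp"
      by (rule less.hyps[OF card_Diff1_less[OF finW C] oV])
    have "card (U \<inter> (W - {C})) < card W"
      using C finW by (intro psubset_card_mono) auto
    then have iI: "homology_iso (subtopology (realization K) (?pre (U \<inter> (W - {C}))))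
        (subtopology (face_space K) (U \<inter> (W - {C}))) supp"
      by (rule less.hyps[OF _ oI])
    have "?pre (U \<inter> (W - {C})) = ?pre U \<inter> ?pre (W - {C})" "?pre W = ?pre U \<union> ?pre (W - {C})"
      using eq by blast+
    moreover have "supp \<in> ?pre U \<rightarrow> U" "supp \<in> ?pre (W - {C}) \<rightarrow> W - {C}" by auto
    ultimately show ?thesis
      using homology_iso_Un[OF cont oU oV pre[OF oU] pre[OF oV] _ _ iU iV] iI eq by metis
  qed
qed

lemma homology_iso_supp:
  assumes "simplicial_complex K" "finite K"
  shows "homology_iso (realization K) (face_space K) supp"
proof -
  have "{t \<in> realization_points K. supp t \<in> K} = realization_points K"
    by (auto simp: realization_points_iff)
  then show ?thesis
    using homology_iso_supp_open[OF assms, of K]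
    by (simp add: openin_face_space subtopology_superset)
qed

section \<open>Simplicial maps and contiguity\<close>

definition simplicial_map :: "'v set set \<Rightarrow> 'w set set \<Rightarrow> ('v \<Rightarrow> 'w) \<Rightarrow> bool" where
  "simplicial_map K L f \<longleftrightarrow> (\<forall>\<sigma>\<in>K. f ` \<sigma> \<in> L)"

lemma realization_map_eq: "realization_map f t w = sum t {v \<in> supp t. f v = w}"
  by (simp add: realization_map_def supp_def)

lemma realization_map_nonneg: "(\<And>v. 0 \<le> t v) \<Longrightarrow> 0 \<le> realization_map f t w"
  by (simp add: realization_map_eq sum_nonneg)

text \<open>Nonnegative coordinates cannot cancel in the sum over a fibre.\<close>

lemma supp_realization_map:
  assumes "\<And>v. 0 \<le> t v" "finite (supp t)"
  shows "supp (realization_map f t) = f ` supp t"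
proof -
  have "realization_map f t w \<noteq> 0 \<longleftrightarrow> (\<exists>v\<in>supp t. f v = w)" for w
    using assms by (auto simp: realization_map_eq sum_nonneg_eq_0_iff supp_def)
  then show ?thesis by (auto simp: supp_def[of "realization_map f t"])
qed

lemma realization_map_compose:
  assumes "\<And>v. 0 \<le> t v" "finite (supp t)"
  shows "realization_map g (realization_map f t) = realization_map (g \<circ> f) t"
proof
  fix u
  let ?S = "{v \<in> supp t. g (f v) = u}" and ?T = "{w \<in> f ` supp t. g w = u}"
  have "realization_map g (realization_map f t) u = (\<Sum>w\<in>?T. sum t {v \<in> supp t. f v = w})"
    by (simp add: realization_map_eq[of g] supp_realization_map[OF assms]) (simp add: realization_map_eq)
  also have "\<dots> = (\<Sum>w\<in>?T. sum t {v \<in> ?S. f v = w})"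
    by (intro sum.cong refl arg_cong[where f = "sum t"]) auto
  also have "\<dots> = sum t ?S"
    using assms by (intro sum.group) auto
  finally show "realization_map g (realization_map f t) u = realization_map (g \<circ> f) t u"
    by (simp add: realization_map_eq)
qed

lemma realization_map_in_points:
  assumes "simplicial_map K L f" "\<And>\<sigma>. \<sigma> \<in> K \<Longrightarrow> finite \<sigma>" "t \<in> realization_points K"
  shows "realization_map f t \<in> realization_points L"
proof -
  have t: "\<And>v. 0 \<le> t v" "finite (supp t)" "supp t \<in> K" "sum t (supp t) = 1"
    using assms by (auto simp: realization_points_iff)
  have "(\<Sum>w\<in>f ` supp t. realization_map f t w) = sum t (supp t)"
    unfolding realization_map_eq using t by (intro sum.group) auto
  then show ?thesis
    using t assms(1) supp_realization_map[OF t(1,2), of f]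
    by (simp add: realization_points_iff realization_map_nonneg simplicial_map_def)
qed

text \<open>Tested on each closed simplex: there the coordinates are fixed finite sums, and the
  values stay in the closed simplex spanned by the image of \<sigma>, where \<open>W\<close> is
  known to be open.\<close>

lemma continuous_realization_map:
  assumes f: "simplicial_map K L f" and fin: "\<And>\<sigma>. \<sigma> \<in> K \<Longrightarrow> finite \<sigma>"
  shows "continuous_map (realization K) (realization L) (realization_map f)"
  unfolding continuous_map
proof (intro conjI allI impI)
  show "realization_map f ` topspace (realization K) \<subseteq> topspace (realization L)"
    using realization_map_in_points[OF f fin] by auto
  fix W assume W: "openin (realization L) W"
  have "openin (top_of_set (closed_simplex K \<sigma>))
      ({t \<in> realization_points K. realization_map f t \<in> W} \<inter> closed_simplex K \<sigma>)" if \<sigma>: "\<sigma> \<in> K" for \<sigma>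
  proof -
    \<comment> \<open>The sum over \<open>supp t\<close>, which varies with \<open>t\<close>, is
      extended by zeros to the fixed set \<sigma>.\<close>
    have "realization_map f t w = sum t {v \<in> \<sigma>. f v = w}" if "t \<in> closed_simplex K \<sigma>" for t w
      unfolding realization_map_eq
      using that fin[OF \<sigma>] by (intro sum.mono_neutral_left) (auto simp: closed_simplex_iff supp_def)
    moreover have "continuous_on (closed_simplex K \<sigma>) (\<lambda>t w. sum t {v \<in> \<sigma>. f v = w})"
      by (intro continuous_on_coordinatewise_then_product continuous_on_sum
          continuous_on_subset[OF continuous_on_product_coordinates]) auto
    ultimately have "continuous_on (closed_simplex K \<sigma>) (realization_map f)"
      by (subst continuous_on_cong[OF refl]) auto
    moreover have im: "realization_map f t \<in> closed_simplex L (f ` \<sigma>)" if t: "t \<in> closed_simplex K \<sigma>" for t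
    proof -
      have "supp t \<subseteq> \<sigma>" "\<And>v. 0 \<le> t v" "t \<in> realization_points K"
        using t by (auto simp: closed_simplex_iff realization_points_iff)
      then show ?thesis
        using realization_map_in_points[OF f fin] supp_realization_map[of t f] finite_subset[OF _ fin[OF \<sigma>]]
        by (auto simp: closed_simplex_iff)
    qed
    moreover have "openin (top_of_set (closed_simplex L (f ` \<sigma>))) (W \<inter> closed_simplex L (f ` \<sigma>))"
      using W f \<sigma> by (simp add: openin_realization_iff simplicial_map_def)
    ultimately have "openin (top_of_set (closed_simplex K \<sigma>))
        (closed_simplex K \<sigma> \<inter> realization_map f -` (W \<inter> closed_simplex L (f ` \<sigma>)))"
      by (intro continuous_openin_preimage) auto
    moreover have "closed_simplex K \<sigma> \<inter> realization_map f -` (W \<inter> closed_simplex L (f ` \<sigma>))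
        = {t \<in> realization_points K. realization_map f t \<in> W} \<inter> closed_simplex K \<sigma>"
      using im by (auto simp: closed_simplex_iff)
    ultimately show ?thesis by simp
  qed
  then show "openin (realization K) {x \<in> topspace (realization K). realization_map f x \<in> W}"
    by (auto simp: openin_realization_iff)
qed

section \<open>Induced homomorphisms and contiguous maps\<close>

abbreviation simplicial_hom ::
    "int \<Rightarrow> 'v set set \<Rightarrow> 'w set set \<Rightarrow> ('v \<Rightarrow> 'w) \<Rightarrow> ('v \<Rightarrow> real) chain set \<Rightarrow> ('w \<Rightarrow> real) chain set" where
  "simplicial_hom p K L f \<equiv> hom_induced p (realization K) {} (realization L) {} (realization_map f)"

abbreviation face_hom ::
    "int \<Rightarrow> 'v set set \<Rightarrow> 'w set set \<Rightarrow> ('v set \<Rightarrow> 'w set) \<Rightarrow> 'v set chain set \<Rightarrow> 'w set chain set" where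
  "face_hom p K L f \<equiv> hom_induced p (face_space K) {} (face_space L) {} f"

abbreviation supp_hom :: "int \<Rightarrow> 'v set set \<Rightarrow> ('v \<Rightarrow> real) chain set \<Rightarrow> 'v set chain set" where
  "supp_hom p K \<equiv> hom_induced p (realization K) {} (face_space K) {} supp"

lemma simplicial_hom_compose:
  assumes f: "simplicial_map K L f" and g: "simplicial_map L M g"
    and KL: "simplicial_complex K" "simplicial_complex L"
  shows "simplicial_hom p L M g (simplicial_hom p K L f c) = simplicial_hom p K M (g \<circ> f) c"
proof -
  have fin: "\<And>\<sigma>. \<sigma> \<in> K \<Longrightarrow> finite \<sigma>" "\<And>\<sigma>. \<sigma> \<in> L \<Longrightarrow> finite \<sigma>"
    using KL by (auto simp: simplicial_complex_def)
  have "simplicial_hom p L M g (simplicial_hom p K L f c)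
      = hom_induced p (realization K) {} (realization M) {} (realization_map g \<circ> realization_map f) c"
    using continuous_realization_map[OF f fin(1)] continuous_realization_map[OF g fin(2)]
    by (intro hom_induced_compose') auto
  \<comment> \<open>The composition law holds at points of the realization, and induced maps depend
    only on the values there.\<close>
  also have "hom_induced p (realization K) {} (realization M) {} (realization_map g \<circ> realization_map f)
      = simplicial_hom p K M (g \<circ> f)"
    using fin(1) by (intro hom_induced_eq) (auto simp: realization_points_iff realization_map_compose)
  finally show ?thesis .
qed

lemma face_map_image: "simplicial_map K L f \<Longrightarrow> face_map K L ((`) f)"
  by (auto simp: simplicial_map_def face_map_def)

text \<open>The pointwise union is a face map above both \<open>f\<close> and \<open>g\<close>,
  hence homotopic to each. This is contiguity for maps that need not come from vertices.\<close>

lemma face_hom_eq: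
  assumes f: "face_map K L f" and g: "face_map K L g" and fg: "\<And>C. C \<in> K \<Longrightarrow> f C \<union> g C \<in> L"
  shows "face_hom p K L f = face_hom p K L g"
proof -
  have h: "face_map K L (\<lambda>C. f C \<union> g C)"
    unfolding face_map_def
  proof (intro conjI ballI impI)
    show "(\<lambda>C. f C \<union> g C) \<in> K \<rightarrow> L" using fg by blast
    fix C D assume "C \<in> K" "D \<in> K" "C \<subseteq> D"
    then show "f C \<union> g C \<subseteq> f D \<union> g D"
      using f g by (intro Un_mono) (simp_all add: face_map_def)
  qed
  have "face_hom p K L f = face_hom p K L (\<lambda>C. f C \<union> g C)"
    by (intro homology_homotopy_empty homotopic_face_maps f h) auto
  also have "\<dots> = face_hom p K L g"
    by (intro homology_homotopy_empty homotopic_with_symD[OF homotopic_face_maps] g h) auto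
  finally show ?thesis .
qed

text \<open>Lets statements about affine maps be checked on spaces of faces, where homotopies are
  combinatorial.\<close>

lemma supp_hom_natural:
  assumes f: "simplicial_map K L f"
    and KL: "simplicial_complex K" "simplicial_complex L"
  shows "supp_hom p L (simplicial_hom p K L f c) = face_hom p K L ((`) f) (supp_hom p K c)"
proof -
  have fin: "\<And>\<sigma>. \<sigma> \<in> K \<Longrightarrow> finite \<sigma>" "\<And>\<sigma>. \<sigma> \<in> L \<Longrightarrow> finite \<sigma>"
    using KL by (auto simp: simplicial_complex_def)
  have "supp_hom p L (simplicial_hom p K L f c)
      = hom_induced p (realization K) {} (face_space L) {} (supp \<circ> realization_map f) c"
    using continuous_realization_map[OF f fin(1)] continuous_map_supp[of L] fin(2)
    by (intro hom_induced_compose') auto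
  also have "hom_induced p (realization K) {} (face_space L) {} (supp \<circ> realization_map f)
      = hom_induced p (realization K) {} (face_space L) {} ((`) f \<circ> supp)"
    using fin(1) by (intro hom_induced_eq) (auto simp: realization_points_iff supp_realization_map)
  also have "hom_induced p (realization K) {} (face_space L) {} ((`) f \<circ> supp) c
      = face_hom p K L ((`) f) (supp_hom p K c)"
    using continuous_face_map[OF face_map_image[OF f]] continuous_map_supp[of K] fin(1)
    by (intro hom_induced_compose'[symmetric]) auto
  finally show ?thesis .
qed

lemma supp_hom_iso:
  assumes "simplicial_complex K" "finite K"
  shows "supp_hom p K \<in> iso (homology_group p (realization K)) (homology_group p (face_space K))"
  using homology_iso_supp[OF assms] by (simp add: homology_iso_def)

lemma simplicial_map_of_contiguous:
  assumes "simplicial_complex K" "simplicial_complex L" "\<And>\<sigma>. \<sigma> \<in> K \<Longrightarrow> f ` \<sigma> \<union> g ` \<sigma> \<in> L"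
  shows "simplicial_map K L f" "simplicial_map K L g"
proof -
  have "f ` \<sigma> \<in> L \<and> g ` \<sigma> \<in> L" if "\<sigma> \<in> K" for \<sigma>
    using that assms unfolding simplicial_complex_def
    by (metis Un_upper1 Un_upper2 image_is_empty)
  then show "simplicial_map K L f" "simplicial_map K L g"
    by (auto simp: simplicial_map_def)
qed

text \<open>The maps already agree in the homology of the space of faces of \<open>L\<close>, and
  the support map of \<open>L\<close> is injective in homology because \<open>L\<close> is
  finite.\<close>

lemma simplicial_hom_contiguous_finite:
  assumes K: "simplicial_complex K" and L: "simplicial_complex L" "finite L"
    and fg: "\<And>\<sigma>. \<sigma> \<in> K \<Longrightarrow> f ` \<sigma> \<union> g ` \<sigma> \<in> L"
  shows "simplicial_hom p K L f = simplicial_hom p K L g"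
proof
  fix c
  note s = simplicial_map_of_contiguous[OF K L(1) fg]
  have "face_hom p K L ((`) f) = face_hom p K L ((`) g)"
    using fg by (intro face_hom_eq face_map_image s) auto
  then have "supp_hom p L (simplicial_hom p K L f c) = supp_hom p L (simplicial_hom p K L g c)"
    using supp_hom_natural[OF s(1) K L(1)] supp_hom_natural[OF s(2) K L(1)] by simp
  moreover have "inj_on (supp_hom p L) (carrier (homology_group p (realization L)))"
    using supp_hom_iso[OF L, of p] by (simp add: iso_def bij_betw_def)
  ultimately show "simplicial_hom p K L f c = simplicial_hom p K L g c"
    by (meson hom_induced_carrier inj_onD)
qed

text \<open>Only finiteness of \<open>K\<close> matters: both maps land in a finite subcomplex of \<open>L\<close>.\<close>

lemma simplicial_hom_contiguous:
  assumes K: "simplicial_complex K" "finite K" and L: "simplicial_complex L"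
    and fg: "\<And>\<sigma>. \<sigma> \<in> K \<Longrightarrow> f ` \<sigma> \<union> g ` \<sigma> \<in> L"
  shows "simplicial_hom p K L f = simplicial_hom p K L g"
proof
  fix c
  \<comment> \<open>In the application \<open>L\<close> may be the nerve of an infinite cover, so
    the complex generated by the images is used instead.\<close>
  define M where "M = (\<Union>\<sigma>\<in>K. Pow (f ` \<sigma> \<union> g ` \<sigma>)) - {{}}"
  have fin: "\<And>\<sigma>. \<sigma> \<in> K \<Longrightarrow> finite \<sigma>" using K by (simp add: simplicial_complex_def)
  have finM: "finite \<rho>" if "\<rho> \<in> M" for \<rho>
    using that fin by (auto simp: M_def dest: finite_subset)
  have M: "finite M" "simplicial_complex M"
  proof -
    show "finite M" using K(2) fin by (auto simp: M_def)
    show "simplicial_complex M"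
      using finM unfolding simplicial_complex_def by (fastforce simp: M_def)
  qed
  have "M \<subseteq> L" using fg L by (auto simp: M_def simplicial_complex_def)
  then have i: "simplicial_map M L id" by (auto simp: simplicial_map_def)
  have fgM: "f ` \<sigma> \<union> g ` \<sigma> \<in> M" if "\<sigma> \<in> K" for \<sigma>
  proof -
    have "\<sigma> \<noteq> {}" using that K by (simp add: simplicial_complex_def)
    then show ?thesis unfolding M_def using that by blast
  qed
  note s = simplicial_map_of_contiguous[OF K(1) M(2) fgM]
  have "simplicial_hom p K L f c = simplicial_hom p M L id (simplicial_hom p K M f c)"
    using simplicial_hom_compose[OF s(1) i K(1) M(2)] by simp
  also have "simplicial_hom p K M f = simplicial_hom p K M g"
    by (rule simplicial_hom_contiguous_finite[OF K(1) M(2,1) fgM])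
  also have "simplicial_hom p M L id (simplicial_hom p K M g c) = simplicial_hom p K L g c"
    using simplicial_hom_compose[OF s(2) i K(1) M(2)] by simp
  finally show "simplicial_hom p K L f c = simplicial_hom p K L g c" .
qed

section \<open>Elements of inverse limits, nerves and small sets\<close>

lemma carrier_inverse_limit_iff:
  "x \<in> carrier (inverse_limit I G F) \<longleftrightarrow>
     x \<in> (\<Pi>\<^sub>E i\<in>I. carrier (G i)) \<and> (\<forall>(i, j, f)\<in>F. f (x j) = x i)"
  by (simp add: inverse_limit_def product_group_def)

lemma mult_inverse_limit: "x \<otimes>\<^bsub>inverse_limit I G F\<^esub> y = (\<lambda>i\<in>I. x i \<otimes>\<^bsub>G i\<^esub> y i)"
  by (simp add: inverse_limit_def product_group_def)

lemma ball_Collect_triple: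
  "(\<forall>(i, j, f)\<in>{(v, w, h v w q) | v w q. P v w q}. Q i j f) \<longleftrightarrow> (\<forall>v w q. P v w q \<longrightarrow> Q v w (h v w q))"
  by blast

lemma ball_subset_ball:
  fixes x y :: "'a::metric_space"
  assumes "dist x y + r \<le> s"
  shows "ball x r \<subseteq> ball y s"
proof
  fix z assume "z \<in> ball x r"
  then show "z \<in> ball y s" using assms dist_triangle[of y z x] by (simp add: dist_commute)
qed

lemma simplicial_complex_nerve: "simplicial_complex (nerve \<V>)"
  unfolding simplicial_complex_def
proof (intro ballI conjI allI impI)
  fix \<sigma> \<rho> assume \<sigma>: "\<sigma> \<in> nerve \<V>" and \<rho>: "\<rho> \<noteq> {}" "\<rho> \<subseteq> \<sigma>"
  then have "\<Inter>\<sigma> \<subseteq> \<Inter>\<rho>" by blast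
  then show "\<rho> \<in> nerve \<V>" using \<sigma> \<rho> by (auto simp: nerve_def dest: finite_subset)
qed (auto simp: nerve_def)

lemma finite_nerve: "finite \<V> \<Longrightarrow> finite (nerve \<V>)"
  by (rule finite_subset[of _ "Pow \<V>"]) (auto simp: nerve_def)

lemma nerveI: "finite \<sigma> \<Longrightarrow> \<sigma> \<noteq> {} \<Longrightarrow> \<sigma> \<subseteq> \<V> \<Longrightarrow> (\<And>V. V \<in> \<sigma> \<Longrightarrow> x \<in> V) \<Longrightarrow> \<sigma> \<in> nerve \<V>"
  unfolding nerve_def by blast

lemma simplicial_map_refinement_projection:
  assumes "refinement_projection \<W> \<V> p"
  shows "simplicial_map (nerve \<W>) (nerve \<V>) p"
  unfolding simplicial_map_def
proof
  fix \<sigma> assume \<sigma>: "\<sigma> \<in> nerve \<W>"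
  then obtain x where "\<And>W. W \<in> \<sigma> \<Longrightarrow> x \<in> W" by (auto simp: nerve_def)
  then show "p ` \<sigma> \<in> nerve \<V>"
    using \<sigma> assms by (intro nerveI[of _ _ x]) (auto simp: nerve_def refinement_projection_def)
qed

text \<open>On a finite nonempty set the diameter is a maximum, so a strict bound on it amounts to a
  strict bound on every distance.\<close>

lemma small_sets_finite_iff:
  assumes "finite A"
  shows "C \<in> small_sets r A \<longleftrightarrow> C \<noteq> {} \<and> C \<subseteq> A \<and> (\<forall>x\<in>C. \<forall>y\<in>C. dist x y < r)"
proof -
  have "diameter C < r \<longleftrightarrow> (\<forall>x\<in>C. \<forall>y\<in>C. dist x y < r)" if C: "C \<noteq> {}" "finite C"
  proof -
    have "diameter C = Max ((\<lambda>(x, y). dist x y) ` (C \<times> C))"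
      using C by (simp add: diameter_def cSup_eq_Max)
    then show ?thesis using C by auto
  qed
  then show ?thesis using assms by (auto simp: small_sets_def dest: finite_subset)
qed

section \<open>Comparison of the two limits\<close>

locale approximation_sequence =
  fixes X :: "'a::metric_space set" and \<tau> :: "nat \<Rightarrow> real" and B :: "nat \<Rightarrow> 'a set" and p :: int
  assumes compact: "compact X"
    and pos: "\<And>n. \<tau> n > 0"
    and half: "\<And>n. \<tau> (Suc n) < \<tau> n / 2"
    and approx: "\<And>n. approximation X (\<tau> n) (B n)"
begin

abbreviation K :: "nat \<Rightarrow> 'a set set" where
  "K n \<equiv> small_sets (4 * \<tau> n) (B n)"

lemma finite_B: "finite (B n)" and B_subset: "B n \<subseteq> X"
  using approx by (auto simp: approximation_def)

lemmas K_iff = small_sets_finite_iff[OF finite_B]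

lemma finite_K: "finite (K n)"
  by (rule finite_subset[of _ "Pow (B n)"]) (auto simp: K_iff finite_B)

lemma complex_K: "simplicial_complex (K n)"
  unfolding simplicial_complex_def
  using finite_subset[OF _ finite_B] by (auto simp: K_iff subset_iff)

lemma K_finite: "\<sigma> \<in> K n \<Longrightarrow> finite \<sigma>"
  using complex_K[of n] unfolding simplicial_complex_def by blast

lemma tau_add_le: "\<tau> (n + j) \<le> \<tau> n / 2 ^ j"
proof (induction j)
  case (Suc j)
  have "\<tau> (n + Suc j) \<le> \<tau> (n + j) / 2" using half[of "n + j"] by simp
  also have "\<dots> \<le> \<tau> n / 2 ^ j / 2" by (rule divide_right_mono[OF Suc]) simp
  finally show ?case by simp
qed simp

text \<open>Two halvings give the factor 4, so distances within a simplex of \<open>K m\<close> are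
  below \<open>\<tau> n\<close>. This is the source of the gap \<open>n + 2 \<le> m\<close> in what
  follows.\<close>

lemma tau_le_quarter:
  assumes "n + 2 \<le> m"
  shows "4 * \<tau> m \<le> \<tau> n"
proof -
  obtain j where "m = (n + 2) + j" using assms by (auto simp: le_iff_add)
  then have "\<tau> m \<le> \<tau> (n + 2) / 2 ^ j" using tau_add_le[of "n + 2" j] by simp
  also have "\<dots> \<le> \<tau> (n + 2)" using pos[of "n + 2"] by (simp add: divide_le_eq_1 field_simps)
  also have "\<dots> \<le> \<tau> n / 4" using tau_add_le[of n 2] by simp
  finally show ?thesis by simp
qed

lemma tau_small:
  assumes "0 < \<epsilon>"
  obtains n where "\<tau> n < \<epsilon>"
proof -
  obtain j where "\<tau> 0 / \<epsilon> < 2 ^ j" using real_arch_pow[of 2 "\<tau> 0 / \<epsilon>"] by auto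
  then have "\<tau> 0 / 2 ^ j < \<epsilon>" using assms by (simp add: field_simps)
  then show ?thesis using that[of j] tau_add_le[of 0 j] by simp
qed

section \<open>Bonding maps and compatible families of classes\<close>

text \<open>A single-valued selection from the bonding map: as a map of vertices it extends to
  realizations, whereas \<open>bond\<close> acts on faces only.\<close>

definition near :: "nat \<Rightarrow> 'a \<Rightarrow> 'a" where
  "near n x = (SOME b. b \<in> B n \<and> dist x b < \<tau> n)"

lemma near:
  assumes "x \<in> X"
  shows "near n x \<in> B n" "dist x (near n x) < \<tau> n"
proof -
  have "\<exists>b. b \<in> B n \<and> dist x b < \<tau> n" using approx[of n] assms by (auto simp: approximation_def)
  then have "near n x \<in> B n \<and> dist x (near n x) < \<tau> n" unfolding near_def by (rule someI_ex)
  then show "near n x \<in> B n" "dist x (near n x) < \<tau> n" by auto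
qed

lemma bond_subset: "bond \<tau> B n C \<subseteq> B n"
  by (auto simp: bond_def)

text \<open>Two points of the image are less than
  \<open>\<tau> n + 4 * \<tau> (Suc n) + \<tau> n\<close> apart, and the middle term is below
  \<open>2 * \<tau> n\<close>.\<close>

lemma face_map_bond: "face_map (K (Suc n)) (K n) (bond \<tau> B n)"
  unfolding face_map_def
proof (intro conjI ballI impI funcsetI)
  fix C assume C: "C \<in> K (Suc n)"
  then obtain c where c: "c \<in> C" "c \<in> X" using B_subset[of "Suc n"] by (auto simp: K_iff)
  then have "near n c \<in> bond \<tau> B n C" using near[OF c(2), of n] by (auto simp: bond_def)
  moreover have "dist x y < 4 * \<tau> n" if xy: "x \<in> bond \<tau> B n C" "y \<in> bond \<tau> B n C" for x y
  proof -
    obtain a b where "a \<in> C" "b \<in> C" "dist a x < \<tau> n" "dist b y < \<tau> n"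
      using xy by (auto simp: bond_def)
    moreover from this have "dist a b < 4 * \<tau> (Suc n)" using C by (simp add: K_iff)
    moreover have "dist x y \<le> dist a x + dist a b + dist b y"
      using dist_triangle[of x y a] dist_triangle[of a y b] by (simp add: dist_commute)
    ultimately show ?thesis using half[of n] by simp
  qed
  ultimately show "bond \<tau> B n C \<in> K n" using bond_subset by (auto simp: K_iff)
qed (auto simp: bond_def)

lemma bond_in: "C \<in> K (Suc n) \<Longrightarrow> bond \<tau> B n C \<in> K n"
  using face_map_bond[of n] unfolding face_map_def by blast

text \<open>The composite of \<open>j\<close> bonding maps from level \<open>n + j\<close> down to
  level \<open>n\<close>. The recursion splits off the map applied last, so inductions on
  \<open>j\<close> let \<open>n\<close> vary.\<close>

fun bonds :: "nat \<Rightarrow> nat \<Rightarrow> 'a set \<Rightarrow> 'a set" where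
  "bonds n 0 = id"
| "bonds n (Suc j) = bond \<tau> B n \<circ> bonds (Suc n) j"

lemma face_map_bonds: "face_map (K (n + j)) (K n) (bonds n j)"
proof (induction j arbitrary: n)
  case 0
  show ?case by (auto simp: face_map_def)
next
  case (Suc j)
  have "face_map (K (n + Suc j)) (K (Suc n)) (bonds (Suc n) j)" using Suc[of "Suc n"] by simp
  then show ?case
    using face_map_bond[of n] unfolding face_map_def by (auto simp: Pi_iff)
qed

text \<open>The bound reproduces itself: the last map contributes less than \<open>\<tau> n\<close>,
  the earlier ones at most \<open>2 * \<tau> (Suc n)\<close>, which is below
  \<open>\<tau> n\<close>. Hence it does not depend on \<open>j\<close>.\<close>

lemma bonds_close: "b \<in> bonds n j C \<Longrightarrow> \<exists>c\<in>C. dist c b \<le> 2 * \<tau> n"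
proof (induction j arbitrary: n b)
  case 0
  then show ?case using pos[of n] by (auto intro!: bexI[of _ b])
next
  case (Suc j)
  then obtain d where "d \<in> bonds (Suc n) j C" "dist d b < \<tau> n" by (auto simp: bond_def)
  then obtain c where "c \<in> C" "dist c d \<le> 2 * \<tau> (Suc n)" using Suc.IH by blast
  then show ?case
    using half[of n] dist_triangle[of c b d] \<open>dist d b < \<tau> n\<close> by (intro bexI[of _ c]) auto
qed

text \<open>The elements of the inverse limit in the theorem; the index set is all of
  \<open>nat\<close>, so no extensionality condition appears.\<close>

definition thread :: "(nat \<Rightarrow> 'a set chain set) \<Rightarrow> bool" where
  "thread x \<longleftrightarrow> (\<forall>n. x n \<in> carrier (homology_group p (face_space (K n))) \<and>
     face_hom p (K (Suc n)) (K n) (bond \<tau> B n) (x (Suc n)) = x n)"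

lemma thread_bonds:
  assumes "thread x"
  shows "face_hom p (K (n + j)) (K n) (bonds n j) (x (n + j)) = x n"
proof (induction j arbitrary: n)
  case 0
  show ?case
    using assms hom_induced_id[of "x n" p "face_space (K n)" "{}"] by (simp add: thread_def id_def)
next
  case (Suc j)
  have "face_map (K (n + Suc j)) (K (Suc n)) (bonds (Suc n) j)" using face_map_bonds[of "Suc n" j] by simp
  then have "face_hom p (K (n + Suc j)) (K n) (bonds n (Suc j)) (x (n + Suc j))
      = face_hom p (K (Suc n)) (K n) (bond \<tau> B n)
          (face_hom p (K (n + Suc j)) (K (Suc n)) (bonds (Suc n) j) (x (n + Suc j)))"
    unfolding bonds.simps
    by (intro hom_induced_compose'[symmetric] continuous_face_map face_map_bond) auto
  also have "\<dots> = x n" using Suc[of "Suc n"] assms by (simp add: thread_def)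
  finally show ?case .
qed

definition supp_inv :: "nat \<Rightarrow> 'a set chain set \<Rightarrow> ('a \<Rightarrow> real) chain set" where
  "supp_inv n = inv_into (carrier (homology_group p (realization (K n)))) (supp_hom p (K n))"

lemma supp_bij: "bij_betw (supp_hom p (K n)) (carrier (homology_group p (realization (K n))))
    (carrier (homology_group p (face_space (K n))))"
  using supp_hom_iso[OF complex_K finite_K, of p] by (simp add: iso_def)

lemma supp_inv_iso:
  "supp_inv n \<in> iso (homology_group p (face_space (K n))) (homology_group p (realization (K n)))"
  unfolding supp_inv_def
  by (intro group.iso_set_sym supp_hom_iso complex_K finite_K) simp

lemma supp_inv_supp:
  "c \<in> carrier (homology_group p (realization (K n))) \<Longrightarrow> supp_inv n (supp_hom p (K n) c) = c"
  unfolding supp_inv_def using supp_bij by (rule bij_betw_inv_into_left)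

lemma supp_supp_inv:
  "c \<in> carrier (homology_group p (face_space (K n))) \<Longrightarrow> supp_hom p (K n) (supp_inv n c) = c"
  unfolding supp_inv_def using supp_bij by (rule bij_betw_inv_into_right)

section \<open>Maps from the complexes to nerves of covers\<close>

text \<open>The radius is the bound on distances in \<open>K n\<close>: every vertex of a simplex
  lies in the members assigned to all its vertices, so these members form a simplex of the
  nerve.\<close>

definition admissible :: "nat \<Rightarrow> ('a \<Rightarrow> 'a set) \<Rightarrow> 'a set set \<Rightarrow> bool" where
  "admissible n \<alpha> \<V> \<longleftrightarrow> (\<forall>b\<in>B n. \<alpha> b \<in> \<V> \<and> X \<inter> ball b (4 * \<tau> n) \<subseteq> \<alpha> b)"

lemma admissibleD:
  assumes "admissible n \<alpha> \<V>" "b \<in> B n"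
  shows "\<alpha> b \<in> \<V>" "x \<in> X \<Longrightarrow> dist b x < 4 * \<tau> n \<Longrightarrow> x \<in> \<alpha> b"
  using assms by (auto simp: admissible_def subset_iff)

lemma near_simplicial:
  assumes t: "\<And>b. b \<in> B m \<Longrightarrow> t b \<in> B n \<and> dist b (t b) < \<tau> n" and m: "n + 2 \<le> m"
  shows "simplicial_map (K m) (K n) t"
    and "thread x \<Longrightarrow> simplicial_hom p (K m) (K n) t (supp_inv m (x m)) = supp_inv n (x n)"
proof -
  have near: "dist (t a) c < \<tau> n + 4 * \<tau> m" if "C \<in> K m" "a \<in> C" "c \<in> C" for C a c
  proof -
    have "a \<in> B m" "dist a c < 4 * \<tau> m" using that by (auto simp: K_iff)
    then show ?thesis using t[of a] dist_triangle[of "t a" c a] by (simp add: dist_commute)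
  qed
  have m4: "4 * \<tau> m \<le> \<tau> n" by (rule tau_le_quarter[OF m])
  have tt: "dist (t a) (t b) < 4 * \<tau> n" if "C \<in> K m" "a \<in> C" "b \<in> C" for C a b
  proof -
    have "b \<in> B m" using that by (auto simp: K_iff)
    then show ?thesis
      using near[OF that] t[of b] m4 pos[of n] dist_triangle[of "t a" "t b" b] by simp
  qed
  show s: "simplicial_map (K m) (K n) t"
    using t tt by (fastforce simp: simplicial_map_def K_iff)
  obtain j where j: "m = n + j" using m by (auto simp: le_iff_add)
  have "t ` C \<union> bonds n j C \<in> K n" if C: "C \<in> K m" for C
  proof -
    have b: "bonds n j C \<in> K n" "t ` C \<in> K n"
      using face_map_bonds[of n j] s C by (auto simp: face_map_def simplicial_map_def j)
    have "dist (t a) b < 4 * \<tau> n" if ab: "a \<in> C" "b \<in> bonds n j C" for a b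
    proof -
      obtain c where "c \<in> C" "dist c b \<le> 2 * \<tau> n" using bonds_close[OF ab(2)] by blast
      then show ?thesis
        using near[OF C ab(1) \<open>c \<in> C\<close>] m4 dist_triangle[of "t a" b c] by simp
    qed
    then show ?thesis using b by (auto simp: K_iff dist_commute)
  qed
  then have eq: "face_hom p (K m) (K n) ((`) t) = face_hom p (K m) (K n) (bonds n j)"
    using s face_map_bonds[of n j] by (intro face_hom_eq face_map_image) (auto simp: j)
  show "simplicial_hom p (K m) (K n) t (supp_inv m (x m)) = supp_inv n (x n)" if x: "thread x"
  proof -
    have c: "x m \<in> carrier (homology_group p (face_space (K m)))" using x by (simp add: thread_def)
    have "supp_hom p (K n) (simplicial_hom p (K m) (K n) t (supp_inv m (x m))) = x n"
      using supp_hom_natural[OF s complex_K complex_K, of p "supp_inv m (x m)"] thread_bonds[OF x, of n j, folded j]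
      by (simp add: supp_supp_inv[OF c] eq)
    then show ?thesis using supp_inv_supp[OF hom_induced_carrier] by metis
  qed
qed

lemma admissible_simplicial:
  assumes "admissible n \<alpha> \<V>"
  shows "simplicial_map (K n) (nerve \<V>) \<alpha>"
  unfolding simplicial_map_def
proof
  fix \<sigma> assume \<sigma>: "\<sigma> \<in> K n"
  then obtain x where x: "x \<in> \<sigma>" by (auto simp: K_iff)
  show "\<alpha> ` \<sigma> \<in> nerve \<V>"
  proof (rule nerveI[of _ _ x])
    show "finite (\<alpha> ` \<sigma>)" using K_finite[OF \<sigma>] by simp
    show "x \<in> V" if V: "V \<in> \<alpha> ` \<sigma>" for V
    proof -
      obtain b where b: "b \<in> \<sigma>" "V = \<alpha> b" using V by blast
      then have "b \<in> B n" "x \<in> X \<inter> ball b (4 * \<tau> n)" using x \<sigma> B_subset[of n] by (auto simp: K_iff)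
      then show ?thesis using assms b admissibleD(2) by auto
    qed
  qed (use \<sigma> assms x in \<open>auto simp: K_iff admissible_def\<close>)
qed

text \<open>Both sides are compared on a common finer complex, where the two maps are contiguous.\<close>

lemma admissible_unique:
  assumes x: "thread x" and a: "admissible n \<alpha> \<V>" and a': "admissible n' \<alpha>' \<V>"
  shows "simplicial_hom p (K n) (nerve \<V>) \<alpha> (supp_inv n (x n))
    = simplicial_hom p (K n') (nerve \<V>) \<alpha>' (supp_inv n' (x n'))"
proof -
  define m where "m = max n n' + 2"
  \<comment> \<open>Proved for any admissible pair and then applied to both. By \<open>**\<close>
    any vertex \<open>b0\<close> of \<sigma> is a common point of all assigned members, whichever
    pair they come from.\<close>
  have *: "simplicial_hom p (K m) (nerve \<V>) (\<gamma> \<circ> near i) (supp_inv m (x m))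
      = simplicial_hom p (K i) (nerve \<V>) \<gamma> (supp_inv i (x i))"
    and **: "\<And>\<sigma> b b0. \<sigma> \<in> K m \<Longrightarrow> b \<in> \<sigma> \<Longrightarrow> b0 \<in> \<sigma> \<Longrightarrow> b0 \<in> \<gamma> (near i b) \<and> \<gamma> (near i b) \<in> \<V>"
    if i: "i + 2 \<le> m" and \<gamma>: "admissible i \<gamma> \<V>" for i \<gamma>
  proof -
    have t: "near i b \<in> B i \<and> dist b (near i b) < \<tau> i" if "b \<in> B m" for b
      using near[of b i] that B_subset by auto
    have s: "simplicial_map (K m) (K i) (near i)"
      and u: "simplicial_hom p (K m) (K i) (near i) (supp_inv m (x m)) = supp_inv i (x i)"
      using near_simplicial[of m "near i" i] t i x by auto
    show "simplicial_hom p (K m) (nerve \<V>) (\<gamma> \<circ> near i) (supp_inv m (x m))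
      = simplicial_hom p (K i) (nerve \<V>) \<gamma> (supp_inv i (x i))"
      using simplicial_hom_compose[OF s admissible_simplicial[OF \<gamma>] complex_K complex_K] u by metis
    fix \<sigma> b b0 assume s: "\<sigma> \<in> K m" "b \<in> \<sigma>" "b0 \<in> \<sigma>"
    then have b: "b \<in> B m" "b0 \<in> X" "dist b b0 < 4 * \<tau> m" using B_subset[of m] by (auto simp: K_iff)
    then have "dist (near i b) b0 < 4 * \<tau> i"
      using t[OF b(1)] tau_le_quarter[OF i] pos[of i] dist_triangle[of "near i b" b0 b]
      by (simp add: dist_commute)
    then show "b0 \<in> \<gamma> (near i b) \<and> \<gamma> (near i b) \<in> \<V>"
      using \<gamma> b t[OF b(1)] admissibleD by blast
  qed
  have i: "n + 2 \<le> m" "n' + 2 \<le> m" by (auto simp: m_def)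
  have "simplicial_hom p (K m) (nerve \<V>) (\<alpha> \<circ> near n) = simplicial_hom p (K m) (nerve \<V>) (\<alpha>' \<circ> near n')"
  proof (rule simplicial_hom_contiguous[OF complex_K finite_K simplicial_complex_nerve])
    fix \<sigma> assume \<sigma>: "\<sigma> \<in> K m"
    then obtain b0 where b0: "b0 \<in> \<sigma>" by (auto simp: K_iff)
    show "(\<alpha> \<circ> near n) ` \<sigma> \<union> (\<alpha>' \<circ> near n') ` \<sigma> \<in> nerve \<V>"
      using **[OF i(1) a \<sigma> _ b0] **[OF i(2) a' \<sigma> _ b0] K_finite[OF \<sigma>] b0
      by (intro nerveI[of _ _ b0]) auto
  qed
  then show ?thesis using *[OF i(1) a] *[OF i(2) a'] by metis
qed

text \<open>A ball of radius \<open>4 * \<tau> n\<close> has diameter at most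
  \<open>8 * \<tau> n\<close>, which is below a Lebesgue number of the cover for suitable
  \<open>n\<close>.\<close>

lemma admissible_exists:
  assumes "open_cover X \<V>"
  shows "\<exists>n \<alpha>. admissible n \<alpha> \<V>"
proof -
  \<comment> \<open>Members of the cover are open only relative to \<open>X\<close>; the Lebesgue
    number lemma is applied to ambient open sets.\<close>
  let ?O = "{T. open T \<and> X \<inter> T \<in> \<V>}"
  have cover: "X \<subseteq> \<Union>?O"
  proof
    fix x assume "x \<in> X"
    then obtain V where V: "V \<in> \<V>" "x \<in> V" using assms by (auto simp: open_cover_def)
    then obtain T where "open T" "V = X \<inter> T" using assms by (auto simp: open_cover_def openin_open)
    then show "x \<in> \<Union>?O" using V by auto
  qed
  show ?thesis
  proof (cases "X = {}")
    case True
    then have "B 0 = {}" using B_subset[of 0] by simp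
    then show ?thesis by (auto simp: admissible_def)
  next
    case False
    then have "?O \<noteq> {}" using cover by force
    then obtain \<delta> where \<delta>: "0 < \<delta>" "\<And>T. \<lbrakk>T \<subseteq> X; diameter T < \<delta>\<rbrakk> \<Longrightarrow> \<exists>S\<in>?O. T \<subseteq> S"
      using Lebesgue_number_lemma[OF compact _ cover] by blast
    obtain n where n: "\<tau> n < \<delta> / 8" using tau_small[of "\<delta> / 8"] \<delta>(1) by auto
    have "\<exists>V. V \<in> \<V> \<and> X \<inter> ball b (4 * \<tau> n) \<subseteq> V" for b
    proof -
      have "dist x y \<le> 8 * \<tau> n" if "x \<in> ball b (4 * \<tau> n)" "y \<in> ball b (4 * \<tau> n)" for x y
        using that dist_triangle3[of x y b] by simp
      \<comment> \<open>Here \<open>b\<close> is arbitrary and the intersection may be empty; its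
        diameter is then 0, and positivity of \<open>\<tau> n\<close> covers that case.\<close>
      then have "diameter (X \<inter> ball b (4 * \<tau> n)) \<le> 8 * \<tau> n"
        using pos[of n] by (auto simp: diameter_def intro!: cSUP_least)
      then obtain S where "S \<in> ?O" "X \<inter> ball b (4 * \<tau> n) \<subseteq> S"
        using \<delta>(2)[of "X \<inter> ball b (4 * \<tau> n)"] n by auto
      then show ?thesis by (intro exI[of _ "X \<inter> S"]) auto
    qed
    then obtain \<alpha> where "\<And>b. \<alpha> b \<in> \<V> \<and> X \<inter> ball b (4 * \<tau> n) \<subseteq> \<alpha> b" by metis
    then show ?thesis by (auto simp: admissible_def)
  qed
qed

section \<open>Maps from nerves of finite covers to the complexes\<close>

text \<open>Radius \<open>2 * \<tau> n\<close> puts the centres of two intersecting members less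
  than \<open>4 * \<tau> n\<close> apart. Finiteness makes the nerve a finite source for the
  contiguity lemma.\<close>

definition coadmissible :: "nat \<Rightarrow> ('a set \<Rightarrow> 'a) \<Rightarrow> 'a set set \<Rightarrow> bool" where
  "coadmissible n \<beta> \<W> \<longleftrightarrow> finite \<W> \<and> open_cover X \<W> \<and> (\<forall>W\<in>\<W>. \<beta> W \<in> B n \<and> W \<subseteq> ball (\<beta> W) (2 * \<tau> n))"

text \<open>All chosen centres lie within \<open>2 * \<tau> n\<close> of one common point of
  \<sigma>. Equal choices give simpliciality, different ones contiguity.\<close>

lemma coadmissible_contiguous:
  assumes \<beta>: "coadmissible n \<beta> \<W>" and \<beta>': "coadmissible n \<beta>' \<W>" and \<sigma>: "\<sigma> \<in> nerve \<W>"
  shows "\<beta> ` \<sigma> \<union> \<beta>' ` \<sigma> \<in> K n"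
proof -
  obtain x where x: "\<And>W. W \<in> \<sigma> \<Longrightarrow> x \<in> W" using \<sigma> by (auto simp: nerve_def)
  have *: "a \<in> B n \<and> dist a x < 2 * \<tau> n" if a: "a \<in> \<beta> ` \<sigma> \<union> \<beta>' ` \<sigma>" for a
  proof -
    obtain W where W: "W \<in> \<sigma>" "a = \<beta> W \<or> a = \<beta>' W" using a by blast
    then have "W \<in> \<W>" "x \<in> W" using \<sigma> x by (auto simp: nerve_def)
    then have "a \<in> B n" "x \<in> ball a (2 * \<tau> n)" using W(2) \<beta> \<beta>' unfolding coadmissible_def by blast+
    then show ?thesis by simp
  qed
  have "dist a b < 4 * \<tau> n" if ab: "a \<in> \<beta> ` \<sigma> \<union> \<beta>' ` \<sigma>" "b \<in> \<beta> ` \<sigma> \<union> \<beta>' ` \<sigma>" for a b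
    using *[OF ab(1)] *[OF ab(2)] dist_triangle2[of a b x] by simp
  moreover have "\<beta> ` \<sigma> \<union> \<beta>' ` \<sigma> \<subseteq> B n" using * by blast
  moreover have "\<beta> ` \<sigma> \<union> \<beta>' ` \<sigma> \<noteq> {}" using \<sigma> by (auto simp: nerve_def)
  ultimately show ?thesis unfolding K_iff by blast
qed

lemma coadmissible_simplicial:
  assumes "coadmissible n \<beta> \<W>"
  shows "simplicial_map (nerve \<W>) (K n) \<beta>"
  unfolding simplicial_map_def using coadmissible_contiguous[OF assms assms] by simp

text \<open>The elements of the Cech limit, up to the extensionality condition.\<close>

definition Cech_family :: "('a set set \<Rightarrow> ('a set \<Rightarrow> real) chain set) \<Rightarrow> bool" where
  "Cech_family y \<longleftrightarrow>
     (\<forall>\<V>. open_cover X \<V> \<longrightarrow> y \<V> \<in> carrier (homology_group p (realization (nerve \<V>)))) \<and>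
     (\<forall>\<V> \<W> q. open_cover X \<V> \<longrightarrow> open_cover X \<W> \<longrightarrow> refinement_projection \<W> \<V> q \<longrightarrow>
        simplicial_hom p (nerve \<W>) (nerve \<V>) q (y \<W>) = y \<V>)"

lemma common_refinement:
  assumes "open_cover X \<V>" "open_cover X \<W>" "finite \<V>" "finite \<W>"
  obtains \<U> q r where "open_cover X \<U>" "finite \<U>" "refinement_projection \<U> \<V> q" "refinement_projection \<U> \<W> r"
proof -
  define \<U> where "\<U> = (\<lambda>(V, W). V \<inter> W) ` (\<V> \<times> \<W>)"
  have "\<Union>\<U> = \<Union>\<V> \<inter> \<Union>\<W>" by (auto simp: \<U>_def)
  then have "open_cover X \<U>" using assms by (auto simp: open_cover_def \<U>_def intro: openin_Int)
  moreover have "finite \<U>" using assms by (simp add: \<U>_def)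
  moreover have "\<forall>U\<in>\<U>. \<exists>V. V \<in> \<V> \<and> U \<subseteq> V" "\<forall>U\<in>\<U>. \<exists>W. W \<in> \<W> \<and> U \<subseteq> W"
    by (auto simp: \<U>_def)
  then obtain q r where "refinement_projection \<U> \<V> q" "refinement_projection \<U> \<W> r"
    unfolding refinement_projection_def by metis
  ultimately show thesis by (rule that)
qed

lemma coadmissible_refine:
  assumes y: "Cech_family y" and \<beta>: "coadmissible n \<beta> \<W>"
    and \<U>: "open_cover X \<U>" "finite \<U>" and q: "refinement_projection \<U> \<W> q"
  shows "coadmissible n (\<beta> \<circ> q) \<U>"
    and "simplicial_hom p (nerve \<U>) (K n) (\<beta> \<circ> q) (y \<U>) = simplicial_hom p (nerve \<W>) (K n) \<beta> (y \<W>)"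
proof -
  show "coadmissible n (\<beta> \<circ> q) \<U>"
    using \<beta> \<U> q unfolding coadmissible_def refinement_projection_def comp_def by blast
  have "simplicial_hom p (nerve \<U>) (nerve \<W>) q (y \<U>) = y \<W>"
    using y \<beta> \<U> q by (simp add: Cech_family_def coadmissible_def)
  then show "simplicial_hom p (nerve \<U>) (K n) (\<beta> \<circ> q) (y \<U>) = simplicial_hom p (nerve \<W>) (K n) \<beta> (y \<W>)"
    using simplicial_hom_compose[OF simplicial_map_refinement_projection[OF q] coadmissible_simplicial[OF \<beta>]
        simplicial_complex_nerve simplicial_complex_nerve, of p "y \<U>"] by simp
qed

text \<open>Both choices are pulled back to a common finite refinement, where any two choices are
  contiguous.\<close>

lemma coadmissible_unique:
  assumes y: "Cech_family y" and \<beta>: "coadmissible n \<beta> \<W>" and \<beta>': "coadmissible n \<beta>' \<W>'"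
  shows "simplicial_hom p (nerve \<W>) (K n) \<beta> (y \<W>) = simplicial_hom p (nerve \<W>') (K n) \<beta>' (y \<W>')"
proof -
  have "open_cover X \<W>" "open_cover X \<W>'" "finite \<W>" "finite \<W>'"
    using \<beta> \<beta>' by (simp_all add: coadmissible_def)
  then obtain \<U> q r where \<U>: "open_cover X \<U>" "finite \<U>"
    and q: "refinement_projection \<U> \<W> q" and r: "refinement_projection \<U> \<W>' r"
    by (rule common_refinement)
  have "simplicial_hom p (nerve \<U>) (K n) (\<beta> \<circ> q) = simplicial_hom p (nerve \<U>) (K n) (\<beta>' \<circ> r)"
    using coadmissible_refine(1)[OF y \<beta> \<U> q] coadmissible_refine(1)[OF y \<beta>' \<U> r]
    by (intro simplicial_hom_contiguous simplicial_complex_nerve finite_nerve \<U> complex_K coadmissible_contiguous)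
  then show ?thesis
    using coadmissible_refine(2)[OF y \<beta> \<U> q] coadmissible_refine(2)[OF y \<beta>' \<U> r] by simp
qed

text \<open>Radius \<open>\<tau> n\<close>, half of what \<open>coadmissible\<close> permits, leaves
  room to move the centres and makes the round trip on \<open>K m\<close> move points less than
  \<open>\<tau> n\<close>.\<close>

definition ball_cover :: "nat \<Rightarrow> 'a set set" where
  "ball_cover n = (\<lambda>b. X \<inter> ball b (\<tau> n)) ` B n"

text \<open>Distinct points may have the same ball in \<open>X\<close>, so a centre has to be
  chosen.\<close>

definition centre :: "nat \<Rightarrow> 'a set \<Rightarrow> 'a" where
  "centre n = inv_into (B n) (\<lambda>b. X \<inter> ball b (\<tau> n))"

lemma centre:
  assumes "W \<in> ball_cover n"
  shows "centre n W \<in> B n" "X \<inter> ball (centre n W) (\<tau> n) = W"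
  using assms unfolding ball_cover_def centre_def
  by (rule inv_into_into, rule f_inv_into_f)

lemma open_cover_ball_cover: "open_cover X (ball_cover n)"
proof -
  have "x \<in> \<Union>(ball_cover n)" if "x \<in> X" for x
    using near[OF that, of n] that by (auto simp: ball_cover_def dist_commute)
  then have "\<Union>(ball_cover n) = X" by (auto simp: ball_cover_def)
  moreover have "openin (top_of_set X) W" if "W \<in> ball_cover n" for W
    using that by (auto simp: ball_cover_def intro: openin_open_Int)
  ultimately show ?thesis by (simp add: open_cover_def)
qed

lemma coadmissible_centre: "coadmissible n (centre n) (ball_cover n)"
  unfolding coadmissible_def
proof (intro conjI ballI)
  show "finite (ball_cover n)" by (simp add: ball_cover_def finite_B)
  fix W assume W: "W \<in> ball_cover n"
  have "ball (centre n W) (\<tau> n) \<subseteq> ball (centre n W) (2 * \<tau> n)"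
    using pos[of n] by (intro subset_ball) simp
  then show "W \<subseteq> ball (centre n W) (2 * \<tau> n)" using centre(2)[OF W] by blast
qed (auto intro: open_cover_ball_cover centre)

section \<open>The two mutually inverse maps of the limits\<close>

text \<open>One admissible choice is fixed per cover; by \<open>admissible_unique\<close> the
  resulting classes do not depend on it.\<close>

definition index :: "'a set set \<Rightarrow> nat" where
  "index \<V> = (SOME n. \<exists>\<alpha>. admissible n \<alpha> \<V>)"

definition vertex_map :: "'a set set \<Rightarrow> 'a \<Rightarrow> 'a set" where
  "vertex_map \<V> = (SOME \<alpha>. admissible (index \<V>) \<alpha> \<V>)"

lemma admissible_vertex_map:
  assumes "open_cover X \<V>"
  shows "admissible (index \<V>) (vertex_map \<V>) \<V>"
  unfolding vertex_map_def index_def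
  using someI_ex[OF admissible_exists[OF assms]] by (rule someI_ex)

text \<open>Restricted to open covers, since elements of the Cech limit are extensional
  families.\<close>

definition to_Cech :: "(nat \<Rightarrow> 'a set chain set) \<Rightarrow> 'a set set \<Rightarrow> ('a set \<Rightarrow> real) chain set" where
  "to_Cech x = (\<lambda>\<V>\<in>Collect (open_cover X).
     simplicial_hom p (K (index \<V>)) (nerve \<V>) (vertex_map \<V>) (supp_inv (index \<V>) (x (index \<V>))))"

definition from_Cech :: "('a set set \<Rightarrow> ('a set \<Rightarrow> real) chain set) \<Rightarrow> nat \<Rightarrow> 'a set chain set" where
  "from_Cech y n = supp_hom p (K n) (simplicial_hom p (nerve (ball_cover n)) (K n) (centre n) (y (ball_cover n)))"

lemma to_Cech_eq:
  assumes "thread x" "open_cover X \<V>" "admissible n \<alpha> \<V>"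
  shows "to_Cech x \<V> = simplicial_hom p (K n) (nerve \<V>) \<alpha> (supp_inv n (x n))"
  using admissible_unique[OF assms(1) admissible_vertex_map[OF assms(2)] assms(3)] assms(2)
  by (simp add: to_Cech_def)

text \<open>Following an admissible choice for \<W> by a refinement projection gives an admissible
  choice for \<V>, so independence of choices yields compatibility.\<close>

lemma Cech_family_to_Cech:
  assumes x: "thread x"
  shows "Cech_family (to_Cech x)"
  unfolding Cech_family_def
proof (intro conjI allI impI)
  show "to_Cech x \<V> \<in> carrier (homology_group p (realization (nerve \<V>)))" if "open_cover X \<V>" for \<V>
    using that by (simp add: to_Cech_def hom_induced_carrier)
  fix \<V> \<W> q assume \<V>: "open_cover X \<V>" and \<W>: "open_cover X \<W>" and q: "refinement_projection \<W> \<V> q"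
  let ?n = "index \<W>" and ?\<alpha> = "vertex_map \<W>"
  have \<alpha>: "admissible ?n ?\<alpha> \<W>" by (rule admissible_vertex_map[OF \<W>])
  then have "admissible ?n (q \<circ> ?\<alpha>) \<V>"
    using q unfolding admissible_def refinement_projection_def comp_def by blast
  then have "to_Cech x \<V> = simplicial_hom p (K ?n) (nerve \<V>) (q \<circ> ?\<alpha>) (supp_inv ?n (x ?n))"
    by (rule to_Cech_eq[OF x \<V>])
  also have "\<dots> = simplicial_hom p (nerve \<W>) (nerve \<V>) q (to_Cech x \<W>)"
    using simplicial_hom_compose[OF admissible_simplicial[OF \<alpha>] simplicial_map_refinement_projection[OF q]
        complex_K simplicial_complex_nerve] to_Cech_eq[OF x \<W> \<alpha>] by simp
  finally show "simplicial_hom p (nerve \<W>) (nerve \<V>) q (to_Cech x \<W>) = to_Cech x \<V>" by simp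
qed

lemma near_image_subset_bond:
  assumes "C \<in> K m"
  shows "near n ` C \<subseteq> bond \<tau> B n C"
proof
  fix b assume "b \<in> near n ` C"
  then obtain c where c: "c \<in> C" "b = near n c" by blast
  then have "c \<in> X" using assms B_subset[of m] by (auto simp: K_iff)
  then show "b \<in> bond \<tau> B n C" using c near[of c n] by (auto simp: bond_def)
qed

text \<open>The gap is a single level, too small for \<open>near_simplicial\<close>; instead the
  image is a nonempty face of \<open>bond \<tau> B n C\<close>.\<close>

lemma near_simplicial_Suc: "simplicial_map (K (Suc n)) (K n) (near n)"
  unfolding simplicial_map_def
proof
  fix C assume C: "C \<in> K (Suc n)"
  then have "near n ` C \<noteq> {}" by (auto simp: K_iff)
  then show "near n ` C \<in> K n"
    using near_image_subset_bond[OF C, of n] by (rule simplicial_complexD(3)[OF complex_K bond_in[OF C]])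
qed

text \<open>The union of the two images is \<open>bond \<tau> B n C\<close> itself. The bonding map
  is thereby replaced by a vertex map, to which \<open>supp_hom_natural\<close> applies.\<close>

lemma face_hom_bond: "face_hom p (K (Suc n)) (K n) (bond \<tau> B n) = face_hom p (K (Suc n)) (K n) ((`) (near n))"
proof (intro face_hom_eq face_map_bond face_map_image near_simplicial_Suc)
  fix C assume C: "C \<in> K (Suc n)"
  then have "bond \<tau> B n C \<union> near n ` C = bond \<tau> B n C" using near_image_subset_bond[OF C, of n] by blast
  then show "bond \<tau> B n C \<union> near n ` C \<in> K n" using bond_in[OF C] by simp
qed

text \<open>Moving the centres of the finer ball cover by \<open>near n\<close> gives a coadmissible
  choice at level \<open>n\<close>, as \<open>\<tau> (Suc n) + \<tau> n\<close> is below
  \<open>2 * \<tau> n\<close>. It yields the same class as the cover of level \<open>n\<close> by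
  \<open>coadmissible_unique\<close>.\<close>

lemma thread_from_Cech:
  assumes y: "Cech_family y"
  shows "thread (from_Cech y)"
  unfolding thread_def
proof (intro allI conjI)
  fix n
  show "from_Cech y n \<in> carrier (homology_group p (face_space (K n)))"
    by (simp add: from_Cech_def hom_induced_carrier)
  let ?W = "ball_cover (Suc n)" and ?c = "centre (Suc n)"
  have c: "coadmissible (Suc n) ?c ?W" by (rule coadmissible_centre)
  have "near n (?c W) \<in> B n \<and> W \<subseteq> ball (near n (?c W)) (2 * \<tau> n)" if W: "W \<in> ?W" for W
  proof -
    have "?c W \<in> X" "W \<subseteq> ball (?c W) (\<tau> (Suc n))"
      using centre[OF W] B_subset[of "Suc n"] by auto
    moreover have "ball (?c W) (\<tau> (Suc n)) \<subseteq> ball (near n (?c W)) (2 * \<tau> n)"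
      using near(2)[OF \<open>?c W \<in> X\<close>, of n] half[of n] pos[of n]
      by (intro ball_subset_ball) (simp add: dist_commute)
    ultimately show ?thesis using near(1) by blast
  qed
  then have nc: "coadmissible n (near n \<circ> ?c) ?W"
    using c unfolding coadmissible_def by simp
  let ?z = "simplicial_hom p (nerve ?W) (K (Suc n)) ?c (y ?W)"
  have "face_hom p (K (Suc n)) (K n) (bond \<tau> B n) (from_Cech y (Suc n))
      = supp_hom p (K n) (simplicial_hom p (K (Suc n)) (K n) (near n) ?z)"
    unfolding face_hom_bond from_Cech_def
    by (rule supp_hom_natural[OF near_simplicial_Suc complex_K complex_K, symmetric])
  also have "simplicial_hom p (K (Suc n)) (K n) (near n) ?z
      = simplicial_hom p (nerve ?W) (K n) (near n \<circ> ?c) (y ?W)"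
    by (rule simplicial_hom_compose[OF coadmissible_simplicial[OF c] near_simplicial_Suc simplicial_complex_nerve complex_K])
  also have "\<dots> = simplicial_hom p (nerve (ball_cover n)) (K n) (centre n) (y (ball_cover n))"
    by (rule coadmissible_unique[OF y nc coadmissible_centre])
  finally show "face_hom p (K (Suc n)) (K n) (bond \<tau> B n) (from_Cech y (Suc n)) = from_Cech y n"
    by (simp add: from_Cech_def)
qed

lemma to_from_Cech:
  assumes y: "Cech_family y" and \<V>: "open_cover X \<V>"
  shows "to_Cech (from_Cech y) \<V> = y \<V>"
proof -
  let ?n = "index \<V>" and ?\<alpha> = "vertex_map \<V>"
  let ?W = "ball_cover ?n" and ?c = "centre ?n"
  have \<alpha>: "admissible ?n ?\<alpha> \<V>" by (rule admissible_vertex_map[OF \<V>])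
  have r: "refinement_projection ?W \<V> (?\<alpha> \<circ> ?c)"
    unfolding refinement_projection_def
  proof (intro ballI conjI)
    fix W assume W: "W \<in> ?W"
    have "ball (?c W) (\<tau> ?n) \<subseteq> ball (?c W) (4 * \<tau> ?n)"
      using pos[of ?n] by (intro subset_ball) simp
    then have "W \<subseteq> X \<inter> ball (?c W) (4 * \<tau> ?n)" using centre(2)[OF W] by blast
    then show "(?\<alpha> \<circ> ?c) W \<in> \<V>" "W \<subseteq> (?\<alpha> \<circ> ?c) W"
      using \<alpha> centre(1)[OF W] unfolding admissible_def comp_def by blast+
  qed
  have "to_Cech (from_Cech y) \<V> = simplicial_hom p (K ?n) (nerve \<V>) ?\<alpha> (supp_inv ?n (from_Cech y ?n))"
    by (rule to_Cech_eq[OF thread_from_Cech[OF y] \<V> \<alpha>])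
  also have "supp_inv ?n (from_Cech y ?n) = simplicial_hom p (nerve ?W) (K ?n) ?c (y ?W)"
    unfolding from_Cech_def by (rule supp_inv_supp[OF hom_induced_carrier])
  also have "simplicial_hom p (K ?n) (nerve \<V>) ?\<alpha> \<dots> = simplicial_hom p (nerve ?W) (nerve \<V>) (?\<alpha> \<circ> ?c) (y ?W)"
    by (rule simplicial_hom_compose[OF coadmissible_simplicial[OF coadmissible_centre] admissible_simplicial[OF \<alpha>]
        simplicial_complex_nerve complex_K])
  also have "\<dots> = y \<V>" using y r \<V> open_cover_ball_cover by (simp add: Cech_family_def)
  finally show ?thesis .
qed

text \<open>The composite through the nerve of the ball cover moves points of \<open>B m\<close>
  less than \<open>\<tau> n\<close>, so \<open>near_simplicial\<close> identifies its
  effect.\<close>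

lemma from_to_Cech:
  assumes x: "thread x"
  shows "from_Cech (to_Cech x) n = x n"
proof -
  let ?W = "ball_cover n"
  obtain m0 \<alpha>0 where \<alpha>0: "admissible m0 \<alpha>0 ?W" using admissible_exists[OF open_cover_ball_cover] by blast
  define m where "m = max m0 n + 2"
  have m: "m0 + 2 \<le> m" "n + 2 \<le> m" by (auto simp: m_def)
  \<comment> \<open>The level \<open>m0\<close> may be too small for \<open>near_simplicial\<close>;
    preceding the choice by \<open>near m0\<close> transports it to a level at least
    \<open>n + 2\<close>.\<close>
  have \<alpha>: "admissible m (\<alpha>0 \<circ> near m0) ?W" (is "admissible m ?\<alpha> ?W")
    unfolding admissible_def
  proof (intro ballI conjI)
    fix b assume "b \<in> B m"
    then have b: "near m0 b \<in> B m0" "dist b (near m0 b) < \<tau> m0" using near[of b m0] B_subset[of m] by auto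
    have "ball b (4 * \<tau> m) \<subseteq> ball (near m0 b) (4 * \<tau> m0)"
      using b(2) tau_le_quarter[OF m(1)] pos[of m0] by (intro ball_subset_ball) (simp add: dist_commute)
    then show "?\<alpha> b \<in> ?W" "X \<inter> ball b (4 * \<tau> m) \<subseteq> ?\<alpha> b"
      using \<alpha>0 b(1) unfolding admissible_def comp_def by blast+
  qed
  have t: "(centre n \<circ> ?\<alpha>) b \<in> B n \<and> dist b ((centre n \<circ> ?\<alpha>) b) < \<tau> n" if b: "b \<in> B m" for b
  proof -
    have "?\<alpha> b \<in> ?W" "b \<in> ?\<alpha> b"
      using admissibleD[OF \<alpha> b] b B_subset[of m] pos[of m] by auto
    then have "b \<in> ball (centre n (?\<alpha> b)) (\<tau> n)" "centre n (?\<alpha> b) \<in> B n" using centre[of "?\<alpha> b" n] by auto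
    then show ?thesis by (simp add: dist_commute)
  qed
  have "simplicial_hom p (nerve ?W) (K n) (centre n) (to_Cech x ?W)
      = simplicial_hom p (nerve ?W) (K n) (centre n) (simplicial_hom p (K m) (nerve ?W) ?\<alpha> (supp_inv m (x m)))"
    using to_Cech_eq[OF x open_cover_ball_cover \<alpha>] by simp
  also have "\<dots> = simplicial_hom p (K m) (K n) (centre n \<circ> ?\<alpha>) (supp_inv m (x m))"
    by (rule simplicial_hom_compose[OF admissible_simplicial[OF \<alpha>] coadmissible_simplicial[OF coadmissible_centre]
        complex_K simplicial_complex_nerve])
  also have "\<dots> = supp_inv n (x n)"
    by (rule near_simplicial(2)[OF _ m(2) x]) (rule t)
  finally show ?thesis
    using x by (simp add: from_Cech_def supp_supp_inv thread_def)
qed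

text \<open>Multiplicativity is checked for \<open>to_Cech\<close> alone; \<open>from_Cech\<close>
  enters as its set-theoretic inverse.\<close>

lemma inverse_limit_iso_Cech:
  assumes "p = int k"
  shows "inverse_limit UNIV (\<lambda>n. homology_group p (face_space (K n)))
      {(n, Suc n, face_hom p (K (Suc n)) (K n) (bond \<tau> B n)) | n. True} \<cong> Cech_homology_group k X"
    (is "?L \<cong> ?C")
proof -
  have L: "x \<in> carrier ?L \<longleftrightarrow> thread x" for x
    unfolding carrier_inverse_limit_iff thread_def by (auto simp: PiE_UNIV_domain)
  have C: "y \<in> carrier ?C \<longleftrightarrow> y \<in> extensional (Collect (open_cover X)) \<and> Cech_family y" for y
    unfolding Cech_homology_group_def carrier_inverse_limit_iff Cech_family_def PiE_iff ball_Collect_triple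
    unfolding assms
    by (simp only: mem_Collect_eq Ball_def imp_conjL conj_ac)
  have in_C: "to_Cech x \<in> carrier ?C" if "thread x" for x
    using Cech_family_to_Cech[OF that] C by (simp add: to_Cech_def)
  have "to_Cech \<in> hom ?L ?C"
  proof (rule homI)
    fix x y assume "x \<in> carrier ?L" "y \<in> carrier ?L"
    then have x: "thread x" and y: "thread y" unfolding L .
    show "to_Cech x \<in> carrier ?C" by (rule in_C[OF x])
    \<comment> \<open>At each cover \<open>to_Cech\<close> applies this homomorphism to one
      coordinate, and both limits multiply coordinatewise.\<close>
    let ?h = "\<lambda>\<V>. simplicial_hom p (K (index \<V>)) (nerve \<V>) (vertex_map \<V>) \<circ> supp_inv (index \<V>)"
    have h: "?h \<V> \<in> hom (homology_group p (face_space (K (index \<V>)))) (homology_group p (realization (nerve \<V>)))" for \<V>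
      by (rule hom_compose[OF iso_imp_homomorphism[OF supp_inv_iso] hom_induced_hom])
    have "x n \<in> carrier (homology_group p (face_space (K n)))" "y n \<in> carrier (homology_group p (face_space (K n)))" for n
      using x y by (simp_all add: thread_def)
    then have "?h \<V> (x (index \<V>) \<otimes>\<^bsub>homology_group p (face_space (K (index \<V>)))\<^esub> y (index \<V>))
        = ?h \<V> (x (index \<V>)) \<otimes>\<^bsub>homology_group p (realization (nerve \<V>))\<^esub> ?h \<V> (y (index \<V>))" for \<V>
      by (rule hom_mult[OF h])
    then show "to_Cech (x \<otimes>\<^bsub>?L\<^esub> y) = to_Cech x \<otimes>\<^bsub>?C\<^esub> to_Cech y"
      by (simp add: mult_inverse_limit Cech_homology_group_def to_Cech_def flip: assms cong: restrict_cong)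
  qed
  moreover have "bij_betw to_Cech (carrier ?L) (carrier ?C)"
  proof (rule bij_betw_byWitness[where f' = from_Cech])
    show "\<forall>x\<in>carrier ?L. from_Cech (to_Cech x) = x" using L from_to_Cech by auto
    show "\<forall>y\<in>carrier ?C. to_Cech (from_Cech y) = y"
    proof
      fix y assume y: "y \<in> carrier ?C"
      \<comment> \<open>Away from open covers, where \<open>to_from_Cech\<close> says nothing, both
        families are \<open>undefined\<close>.\<close>
      have "to_Cech (from_Cech y) \<in> extensional (Collect (open_cover X))" by (simp add: to_Cech_def)
      moreover have "y \<in> extensional (Collect (open_cover X))" "Cech_family y" using y C by auto
      ultimately show "to_Cech (from_Cech y) = y" using to_from_Cech by (intro extensionalityI) auto
    qed
    show "to_Cech ` carrier ?L \<subseteq> carrier ?C" using in_C L by blast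
    show "from_Cech ` carrier ?C \<subseteq> carrier ?L" using thread_from_Cech L C by blast
  qed
  ultimately show ?thesis by (auto simp: is_iso_def iso_def)
qed

end

theorem proposition4p6:
  fixes X :: "'a::metric_space set" and \<tau> :: "nat \<Rightarrow> real" and B :: "nat \<Rightarrow> 'a set" and k :: nat
  assumes "compact X" and "X \<noteq> {}"
    and "\<And>n. \<tau> n > 0"
    and "\<And>n. \<tau> (Suc n) < \<tau> n / 2"
    and "\<And>n. approximation X (\<tau> n) (B n)"
  shows "inverse_limit UNIV
           (\<lambda>n. homology_group (int k) (small_space (4 * \<tau> n) (B n)))
           {(n, Suc n, hom_induced (int k)
                         (small_space (4 * \<tau> (Suc n)) (B (Suc n))) {}
                         (small_space (4 * \<tau> n) (B n)) {}
                         (bond \<tau> B n)) | n. True}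
         \<cong> Cech_homology_group k X"
proof -
  interpret approximation_sequence X \<tau> B "int k"
    using assms by unfold_locales
  show ?thesis
    unfolding small_space_eq_face_space by (rule inverse_limit_iso_Cech) simp
qed

end
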